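(* Let $R$ be a commutative ring with unit and let $i\in\{1,\dots,6\}$. Let $(\mathcal{A},\mu)$ be a $G_i$-associative algebra over $R$ and let $(C,\Delta)$ be a $G_i^!$-coalgebra over $R$. Then $(Hom(C,\mathcal{A}),\star)$ is a $G_i$-associative algebra, where $\star$ is the convolution product $$f\star g=\mu\circ\lambda_2(f\otimes g)\circ\Delta .$$
   Context: All tensor products are over $R$ and $Hom(C,\mathcal{A})$ is the $R$-module of $R$-linear maps. $\Sigma_3$ is the symmetric group on $\{1,2,3\}$, $(-1)^{\epsilon(\sigma)}$ is the sign of $\sigma$, $\tau_{jk}$ is the transposition exchanging $j$ and $k$, and $c_1,c_2$ are the two $3$-cycles. The subgroups of $\Sigma_3$ are denoted $G_1=\{Id\}$, $G_2=\{Id,\tau_{12}\}$, $G_3=\{Id,\tau_{23}\}$, $G_4=\{Id,\tau_{13}\}$, $G_5=\{Id,c_1,c_2\}$, $G_6=\Sigma_3$. For an $R$-module $N$ and $\sigma\in\Sigma_3$, $\Phi^N_\sigma : N^{\otimes 3}\to N^{\otimes 3}$ is the linear map with $\Phi^N_\sigma(x_1\otimes x_2\otimes x_3)=x_{\sigma^{-1}(1)}\otimes x_{\sigma^{-1}(2)}\otimes x_{\sigma^{-1}(3)}$, and $\Phi^N_{G_i}=\sum_{\sigma\in G_i}(-1)^{\epsilon(\sigma)}\Phi^N_\sigma$. A multiplication $\mu : N\otimes N\to N$ ($R$-linear) on an $R$-module $N$ is $G_i$-associative if $A(\mu)\circ\Phi^N_{G_i}=0$, where $A(\mu)=\mu\circ(\mu\otimes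 Id)-\mu\circ(Id\otimes\mu)$; then $(N,\mu)$ is a $G_i$-associative algebra. No unit is required. A $G_i^!$-coalgebra is an $R$-module $C$ with an $R$-linear map $\Delta : C\to C\otimes C$ that is coassociative, i.e. $(\Delta\otimes Id)\circ\Delta=(Id\otimes\Delta)\circ\Delta$, and satisfies $\Phi^C_{\sigma}\circ(Id\otimes\Delta)\circ\Delta=(Id\otimes\Delta)\circ\Delta$ for every $\sigma\in G_i$. No counit is required. $\lambda_2 : Hom(C,\mathcal{A})^{\otimes 2}\to Hom(C^{\otimes 2},\mathcal{A}^{\otimes 2})$ is the natural map $\lambda_2(f\otimes g)(x\otimes y)=f(x)\otimes g(y)$. *)

theory Defs
  imports "HOL-Combinatorics.Cycles" "HOL-Algebra.QuotRing" "HOL-Algebra.Module" "HOL.Hull"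
begin

text \<open>
  Modules are those of \<^theory>\<open>HOL-Algebra.Module\<close>. The record type of modules extends that of
  rings, but the locale \<^locale>\<open>module\<close> ignores the fields for multiplication and unit; these
  are left undefined in the modules constructed below.
\<close>

section \<open>Linear maps and the module of homomorphisms\<close>

definition linear_maps ::
  "('r, 'p) ring_scheme \<Rightarrow> ('r, 'm, 'q) module_scheme \<Rightarrow> ('r, 'n, 's) module_scheme \<Rightarrow> ('m \<Rightarrow> 'n) set"
  where "linear_maps R M N =
    {f \<in> carrier M \<rightarrow> carrier N.
      (\<forall>x\<in>carrier M. \<forall>y\<in>carrier M. f (x \<oplus>\<^bsub>M\<^esub> y) = f x \<oplus>\<^bsub>N\<^esub> f y) \<and>
      (\<forall>a\<in>carrier R. \<forall>x\<in>carrier M. f (a \<odot>\<^bsub>M\<^esub> x) = a \<odot>\<^bsub>N\<^esub> f x)}"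

text \<open>
  A HOL function is also defined outside the carrier, so the elements of \<open>Hom M N\<close> are taken to be
  extensional: two of them are equal as soon as they agree on the carrier of \<open>M\<close>.
\<close>

definition Hom_module ::
  "('r, 'p) ring_scheme \<Rightarrow> ('r, 'm, 'q) module_scheme \<Rightarrow> ('r, 'n, 's) module_scheme \<Rightarrow> ('r, 'm \<Rightarrow> 'n) module"
  where "Hom_module R M N =
    \<lparr>carrier = linear_maps R M N \<inter> extensional (carrier M),
     mult = undefined, one = undefined,
     zero = (\<lambda>x\<in>carrier M. \<zero>\<^bsub>N\<^esub>),
     add = (\<lambda>f g. \<lambda>x\<in>carrier M. f x \<oplus>\<^bsub>N\<^esub> g x),
     smult = (\<lambda>a f. \<lambda>x\<in>carrier M. a \<odot>\<^bsub>N\<^esub> f x)\<rparr>"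

section \<open>Tensor products\<close>

text \<open>Finitely supported functions from \<open>S\<close> to \<open>R\<close>, extended by zero outside \<open>S\<close>.\<close>

definition free_module :: "('r, 'p) ring_scheme \<Rightarrow> 's set \<Rightarrow> ('r, 's \<Rightarrow> 'r) module"
  where "free_module R S =
    \<lparr>carrier = {\<phi>. (\<forall>s. \<phi> s \<in> carrier R) \<and> finite {s. \<phi> s \<noteq> \<zero>\<^bsub>R\<^esub>} \<and> {s. \<phi> s \<noteq> \<zero>\<^bsub>R\<^esub>} \<subseteq> S},
     mult = undefined, one = undefined,
     zero = (\<lambda>s. \<zero>\<^bsub>R\<^esub>),
     add = (\<lambda>\<phi> \<psi> s. \<phi> s \<oplus>\<^bsub>R\<^esub> \<psi> s),
     smult = (\<lambda>a \<phi> s. a \<otimes>\<^bsub>R\<^esub> \<phi> s)\<rparr>"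

definition free_basis :: "('r, 'p) ring_scheme \<Rightarrow> 's \<Rightarrow> 's \<Rightarrow> 'r"
  where "free_basis R s = (\<lambda>t. if t = s then \<one>\<^bsub>R\<^esub> else \<zero>\<^bsub>R\<^esub>)"

text \<open>In the quotient, \<open>a \<odot> (K + x)\<close> is the union of the cosets \<open>K + a \<odot> y\<close> over all \<open>y \<in> K + x\<close>;
  these all coincide with \<open>K + a \<odot> x\<close> when \<open>K\<close> is a submodule.\<close>

definition quotient_module :: "('r, 'm, 'q) module_scheme \<Rightarrow> 'm set \<Rightarrow> ('r, 'm set) module"
  where "quotient_module M K =
    \<lparr>carrier = a_rcosets\<^bsub>M\<^esub> K,
     mult = undefined, one = undefined,
     zero = K,
     add = set_add M,
     smult = (\<lambda>a X. \<Union>x\<in>X. K +>\<^bsub>M\<^esub> (a \<odot>\<^bsub>M\<^esub> x))\<rparr>"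

definition tensor_relators ::
  "('r, 'p) ring_scheme \<Rightarrow> ('r, 'm, 'q) module_scheme \<Rightarrow> ('r, 'n, 's) module_scheme \<Rightarrow> ('m \<times> 'n \<Rightarrow> 'r) set"
  where "tensor_relators R M N =
    (let F = free_module R (carrier M \<times> carrier N); e = (\<lambda>x y. free_basis R (x, y)) in
      {e (x \<oplus>\<^bsub>M\<^esub> x') y \<ominus>\<^bsub>F\<^esub> (e x y \<oplus>\<^bsub>F\<^esub> e x' y) | x x' y.
          x \<in> carrier M \<and> x' \<in> carrier M \<and> y \<in> carrier N} \<union>
      {e x (y \<oplus>\<^bsub>N\<^esub> y') \<ominus>\<^bsub>F\<^esub> (e x y \<oplus>\<^bsub>F\<^esub> e x y') | x y y'.
          x \<in> carrier M \<and> y \<in> carrier N \<and> y' \<in> carrier N} \<union>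
      {e (a \<odot>\<^bsub>M\<^esub> x) y \<ominus>\<^bsub>F\<^esub> a \<odot>\<^bsub>F\<^esub> e x y | a x y.
          a \<in> carrier R \<and> x \<in> carrier M \<and> y \<in> carrier N} \<union>
      {e x (a \<odot>\<^bsub>N\<^esub> y) \<ominus>\<^bsub>F\<^esub> a \<odot>\<^bsub>F\<^esub> e x y | a x y.
          a \<in> carrier R \<and> x \<in> carrier M \<and> y \<in> carrier N})"

definition tensor_kernel ::
  "('r, 'p) ring_scheme \<Rightarrow> ('r, 'm, 'q) module_scheme \<Rightarrow> ('r, 'n, 's) module_scheme \<Rightarrow> ('m \<times> 'n \<Rightarrow> 'r) set"
  where "tensor_kernel R M N =
    (\<lambda>H. submodule H R (free_module R (carrier M \<times> carrier N))) hull tensor_relators R M N"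

definition tensor ::
  "('r, 'p) ring_scheme \<Rightarrow> ('r, 'm, 'q) module_scheme \<Rightarrow> ('r, 'n, 's) module_scheme
    \<Rightarrow> ('r, ('m \<times> 'n \<Rightarrow> 'r) set) module"
  where "tensor R M N =
    quotient_module (free_module R (carrier M \<times> carrier N)) (tensor_kernel R M N)"

definition tens ::
  "('r, 'p) ring_scheme \<Rightarrow> ('r, 'm, 'q) module_scheme \<Rightarrow> ('r, 'n, 's) module_scheme
    \<Rightarrow> 'm \<Rightarrow> 'n \<Rightarrow> ('m \<times> 'n \<Rightarrow> 'r) set"
  where "tens R M N x y =
    tensor_kernel R M N +>\<^bsub>free_module R (carrier M \<times> carrier N)\<^esub> free_basis R (x, y)"

text \<open>
  The linear map from \<open>M \<otimes> N\<close> to \<open>P\<close> with \<open>x \<otimes> y \<mapsto> \<beta> x y\<close>, for \<open>\<beta>\<close> bilinear: for such a \<open>\<beta>\<close>, the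
  linear extension of \<open>\<beta>\<close> to the free module is constant on each coset.
\<close>

definition tensor_lift ::
  "('r, 'p) ring_scheme \<Rightarrow> ('r, 'k, 'q) module_scheme \<Rightarrow> ('m \<Rightarrow> 'n \<Rightarrow> 'k) \<Rightarrow> ('m \<times> 'n \<Rightarrow> 'r) set \<Rightarrow> 'k"
  where "tensor_lift R P \<beta> X =
    the_elem ((\<lambda>\<phi>. \<Oplus>\<^bsub>P\<^esub>s\<in>{s. \<phi> s \<noteq> \<zero>\<^bsub>R\<^esub>}. \<phi> s \<odot>\<^bsub>P\<^esub> \<beta> (fst s) (snd s)) ` X)"

text \<open>The map \<open>f \<otimes> g\<close>, where \<open>M\<close> and \<open>N\<close> are the codomains of \<open>f\<close> and \<open>g\<close>.\<close>

definition tensor_map ::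
  "('r, 'p) ring_scheme \<Rightarrow> ('r, 'm, 'q) module_scheme \<Rightarrow> ('r, 'n, 's) module_scheme
    \<Rightarrow> ('k \<Rightarrow> 'm) \<Rightarrow> ('l \<Rightarrow> 'n) \<Rightarrow> ('k \<times> 'l \<Rightarrow> 'r) set \<Rightarrow> ('m \<times> 'n \<Rightarrow> 'r) set"
  where "tensor_map R M N f g = tensor_lift R (tensor R M N) (\<lambda>x y. tens R M N (f x) (g y))"

section \<open>The third tensor power\<close>

text \<open>
  \<open>N \<otimes> N \<otimes> N\<close> is realised as \<open>N \<otimes> (N \<otimes> N)\<close>; the canonical isomorphism to \<open>(N \<otimes> N) \<otimes> N\<close> is
  \<open>tensor_assoc\<close>.
\<close>

definition tensor_cube ::
  "('r, 'p) ring_scheme \<Rightarrow> ('r, 'n, 's) module_scheme \<Rightarrow> ('r, ('n \<times> ('n \<times> 'n \<Rightarrow> 'r) set \<Rightarrow> 'r) set) module"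
  where "tensor_cube R N = tensor R N (tensor R N N)"

definition tens3 ::
  "('r, 'p) ring_scheme \<Rightarrow> ('r, 'n, 's) module_scheme
    \<Rightarrow> 'n \<Rightarrow> 'n \<Rightarrow> 'n \<Rightarrow> ('n \<times> ('n \<times> 'n \<Rightarrow> 'r) set \<Rightarrow> 'r) set"
  where "tens3 R N x y z = tens R N (tensor R N N) x (tens R N N y z)"

text \<open>The linear map with \<open>x \<otimes> y \<otimes> z \<mapsto> \<gamma> x y z\<close>, for \<open>\<gamma>\<close> trilinear.\<close>

definition tensor_cube_lift ::
  "('r, 'p) ring_scheme \<Rightarrow> ('r, 'k, 'q) module_scheme \<Rightarrow> ('n \<Rightarrow> 'n \<Rightarrow> 'n \<Rightarrow> 'k)
    \<Rightarrow> ('n \<times> ('n \<times> 'n \<Rightarrow> 'r) set \<Rightarrow> 'r) set \<Rightarrow> 'k"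
  where "tensor_cube_lift R P \<gamma> = tensor_lift R P (\<lambda>x. tensor_lift R P (\<gamma> x))"

definition tensor_assoc ::
  "('r, 'p) ring_scheme \<Rightarrow> ('r, 'n, 's) module_scheme
    \<Rightarrow> ('n \<times> ('n \<times> 'n \<Rightarrow> 'r) set \<Rightarrow> 'r) set \<Rightarrow> (('n \<times> 'n \<Rightarrow> 'r) set \<times> 'n \<Rightarrow> 'r) set"
  where "tensor_assoc R N =
    tensor_cube_lift R (tensor R (tensor R N N) N)
      (\<lambda>x y z. tens R (tensor R N N) N (tens R N N x y) z)"

definition perm_map ::
  "('r, 'p) ring_scheme \<Rightarrow> ('r, 'n, 's) module_scheme \<Rightarrow> (nat \<Rightarrow> nat)
    \<Rightarrow> ('n \<times> ('n \<times> 'n \<Rightarrow> 'r) set \<Rightarrow> 'r) set \<Rightarrow> ('n \<times> ('n \<times> 'n \<Rightarrow> 'r) set \<Rightarrow> 'r) set"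
  where "perm_map R N \<sigma> =
    tensor_cube_lift R (tensor_cube R N)
      (\<lambda>x1 x2 x3.
        let x = (\<lambda>k. [x1, x2, x3] ! (k - 1)); \<tau> = inv_into UNIV \<sigma>
        in tens3 R N (x (\<tau> 1)) (x (\<tau> 2)) (x (\<tau> 3)))"

definition alternating_sum ::
  "('r, 'p) ring_scheme \<Rightarrow> ('r, 'n, 's) module_scheme \<Rightarrow> (nat \<Rightarrow> nat) set
    \<Rightarrow> ('n \<times> ('n \<times> 'n \<Rightarrow> 'r) set \<Rightarrow> 'r) set \<Rightarrow> ('n \<times> ('n \<times> 'n \<Rightarrow> 'r) set \<Rightarrow> 'r) set"
  where "alternating_sum R N G t =
    (\<Oplus>\<^bsub>tensor_cube R N\<^esub>\<sigma>\<in>G. [sign \<sigma>] \<cdot>\<^bsub>tensor_cube R N\<^esub> perm_map R N \<sigma> t)"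

section \<open>Subgroups of the symmetric group on three letters\<close>

definition Sigma3_subgroup :: "nat \<Rightarrow> (nat \<Rightarrow> nat) set"
  where "Sigma3_subgroup i =
    (if i = 1 then {id}
     else if i = 2 then {id, transpose 1 2}
     else if i = 3 then {id, transpose 2 3}
     else if i = 4 then {id, transpose 1 3}
     else if i = 5 then {id, cycle_of_list [1, 2, 3], cycle_of_list [1, 3, 2]}
     else {\<sigma>. \<sigma> permutes {1, 2, 3}})"

section \<open>Algebras and coalgebras\<close>

definition associator ::
  "('r, 'p) ring_scheme \<Rightarrow> ('r, 'n, 's) module_scheme \<Rightarrow> (('n \<times> 'n \<Rightarrow> 'r) set \<Rightarrow> 'n)
    \<Rightarrow> ('n \<times> ('n \<times> 'n \<Rightarrow> 'r) set \<Rightarrow> 'r) set \<Rightarrow> 'n"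
  where "associator R N \<mu> t =
    \<mu> (tensor_map R N N \<mu> id (tensor_assoc R N t)) \<ominus>\<^bsub>N\<^esub> \<mu> (tensor_map R N N id \<mu> t)"

locale G_associative_algebra = module R N
  for G :: "(nat \<Rightarrow> nat) set" and R (structure) and N (structure)
    and \<mu> :: "('n \<times> 'n \<Rightarrow> 'r) set \<Rightarrow> 'n" +
  assumes mult_linear: "\<mu> \<in> linear_maps R (tensor R N N) N"
    and G_associative: "\<forall>t\<in>carrier (tensor_cube R N). associator R N \<mu> (alternating_sum R N G t) = \<zero>\<^bsub>N\<^esub>"

text \<open>Coassociativity is stated in \<open>(C \<otimes> C) \<otimes> C\<close>, the invariance in \<open>C \<otimes> (C \<otimes> C)\<close>.\<close>

locale G_dual_coalgebra = module R C
  for G :: "(nat \<Rightarrow> nat) set" and R (structure) and C (structure)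
    and \<Delta> :: "'c \<Rightarrow> ('c \<times> 'c \<Rightarrow> 'r) set" +
  assumes comult_linear: "\<Delta> \<in> linear_maps R C (tensor R C C)"
    and coassociative: "\<forall>x\<in>carrier C.
      tensor_map R (tensor R C C) C \<Delta> id (\<Delta> x) = tensor_assoc R C (tensor_map R C (tensor R C C) id \<Delta> (\<Delta> x))"
    and G_invariant: "\<forall>\<sigma>\<in>G. \<forall>x\<in>carrier C.
      perm_map R C \<sigma> (tensor_map R C (tensor R C C) id \<Delta> (\<Delta> x)) = tensor_map R C (tensor R C C) id \<Delta> (\<Delta> x)"

section \<open>The convolution product\<close>

definition lambda2 ::
  "('r, 'p) ring_scheme \<Rightarrow> ('r, 'c, 'q) module_scheme \<Rightarrow> ('r, 'a, 's) module_scheme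
    \<Rightarrow> (('c \<Rightarrow> 'a) \<times> ('c \<Rightarrow> 'a) \<Rightarrow> 'r) set \<Rightarrow> ('c \<times> 'c \<Rightarrow> 'r) set \<Rightarrow> ('a \<times> 'a \<Rightarrow> 'r) set"
  where "lambda2 R C A =
    tensor_lift R (Hom_module R (tensor R C C) (tensor R A A))
      (\<lambda>f g. restrict (tensor_map R A A f g) (carrier (tensor R C C)))"

text \<open>The product as a map on the tensor square of \<open>Hom C A\<close>, like \<open>\<mu>\<close> on that of \<open>A\<close>; on
  \<open>f \<otimes> g\<close> its value is \<open>f \<star> g\<close>.\<close>

definition convolution ::
  "('r, 'p) ring_scheme \<Rightarrow> ('r, 'c, 'q) module_scheme \<Rightarrow> ('r, 'a, 's) module_scheme
    \<Rightarrow> (('a \<times> 'a \<Rightarrow> 'r) set \<Rightarrow> 'a) \<Rightarrow> ('c \<Rightarrow> ('c \<times> 'c \<Rightarrow> 'r) set)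
    \<Rightarrow> (('c \<Rightarrow> 'a) \<times> ('c \<Rightarrow> 'a) \<Rightarrow> 'r) set \<Rightarrow> 'c \<Rightarrow> 'a"
  where "convolution R C A \<mu> \<Delta> t = restrict (\<mu> \<circ> lambda2 R C A t \<circ> \<Delta>) (carrier C)"

end

theory Submission
  imports Defs
begin

text \<open>
  Put \<open>T = (Id \<otimes> \<Delta>) \<circ> \<Delta>\<close>. Coassociativity turns the associator of the convolution product into that of
  \<open>\<mu>\<close>: \<open>A(\<star>)(f\<^sub>1 \<otimes> f\<^sub>2 \<otimes> f\<^sub>3) = A(\<mu>) \<circ> (f\<^sub>1 \<otimes> f\<^sub>2 \<otimes> f\<^sub>3) \<circ> T\<close>. Permuting the three maps on the
  left amounts to permuting the tensors on both sides of \<open>f\<^sub>1 \<otimes> f\<^sub>2 \<otimes> f\<^sub>3\<close> on the right, and the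
  permutation applied first is absorbed by the invariance of \<open>T\<close>. Summing over the subgroup with signs,
  \<open>A(\<star>) \<circ> \<Phi>\<^sub>G\<close> at \<open>f\<^sub>1 \<otimes> f\<^sub>2 \<otimes> f\<^sub>3\<close> is \<open>A(\<mu>) \<circ> \<Phi>\<^sub>G\<close> composed with \<open>(f\<^sub>1 \<otimes> f\<^sub>2 \<otimes> f\<^sub>3) \<circ> T\<close>,
  hence zero.
\<close>

section \<open>Linear maps\<close>

text \<open>Over an arbitrary commutative ring the natural map from the third tensor power of
  \<open>Hom(C,A)\<close> to the linear maps between the tensor cubes of \<open>C\<close> and
  \<open>A\<close> need be neither injective nor surjective, so tensors of maps are never identified
  with maps of tensors. Instead both sides of an identity are shown to be linear in the tensor and
  compared on pure tensors, and evaluation at a point \<open>x\<close> of \<open>C\<close>, itself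
  linear, carries equations from \<open>Hom(C,A)\<close> to \<open>A\<close>.

  The two signed sums agree term by term because permutations are natural: with
  \<open>\<tau>\<close> the inverse of \<open>\<sigma>\<close>, applying \<open>\<sigma>\<close> and
  then the maps with indices \<open>\<tau> 1\<close>, \<open>\<tau> 2\<close>,
  \<open>\<tau> 3\<close> is the same as applying the maps 1, 2, 3 and then \<open>\<sigma>\<close>.
  The same \<open>\<sigma>\<close> stands on both sides, so each term keeps its sign and the sum is
  not reindexed by inverses.

  The concrete quotient behind \<open>tensor\<close> is opened only up to the universal property;
  afterwards the tools are bilinearity of \<open>tens\<close>, existence of lifts and generation by
  pure tensors.\<close>

lemma linear_mapsI:
  assumes "\<And>x. x \<in> carrier M \<Longrightarrow> f x \<in> carrier N"
    and "\<And>x y. x \<in> carrier M \<Longrightarrow> y \<in> carrier M \<Longrightarrow> f (x \<oplus>\<^bsub>M\<^esub> y) = f x \<oplus>\<^bsub>N\<^esub> f y"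
    and "\<And>a x. a \<in> carrier R \<Longrightarrow> x \<in> carrier M \<Longrightarrow> f (a \<odot>\<^bsub>M\<^esub> x) = a \<odot>\<^bsub>N\<^esub> f x"
  shows "f \<in> linear_maps R M N"
  using assms by (auto simp: linear_maps_def)

lemma linear_mapsD:
  assumes "f \<in> linear_maps R M N"
  shows linear_maps_closed: "x \<in> carrier M \<Longrightarrow> f x \<in> carrier N"
    and linear_maps_add: "x \<in> carrier M \<Longrightarrow> y \<in> carrier M \<Longrightarrow> f (x \<oplus>\<^bsub>M\<^esub> y) = f x \<oplus>\<^bsub>N\<^esub> f y"
    and linear_maps_smult: "a \<in> carrier R \<Longrightarrow> x \<in> carrier M \<Longrightarrow> f (a \<odot>\<^bsub>M\<^esub> x) = a \<odot>\<^bsub>N\<^esub> f x"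
  using assms by (auto simp: linear_maps_def)

text \<open>Values outside the carrier are unconstrained, so a map may be exchanged for its
  restriction, or for a formula that agrees with it only on the carrier. \<open>M\<close> must be a
  module for sums and multiples to stay where the two agree.\<close>

lemma linear_maps_cong:
  assumes "f \<in> linear_maps R M N" and "module R M" and "\<And>x. x \<in> carrier M \<Longrightarrow> g x = f x"
  shows "g \<in> linear_maps R M N"
proof -
  interpret M: module R M by fact
  show ?thesis
    using assms by (auto simp: linear_maps_def)
qed

lemma linear_maps_id: "id \<in> linear_maps R M M"
  by (simp add: linear_maps_def)

lemma linear_maps_comp:
  assumes "f \<in> linear_maps R M N" and "g \<in> linear_maps R N P"
  shows "(\<lambda>x. g (f x)) \<in> linear_maps R M P"
  using assms by (auto simp: linear_maps_def Pi_iff)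

lemma linear_maps_abelian_group_hom:
  assumes "f \<in> linear_maps R M N" and "module R M" and "module R N"
  shows "abelian_group_hom M N f"
proof -
  interpret M: module R M by fact
  interpret N: module R N by fact
  show ?thesis
    using assms(1)
    by (intro abelian_group_homI M.abelian_group_axioms N.abelian_group_axioms)
      (auto simp: group_hom_def group_hom_axioms_def hom_def linear_maps_def M.a_group N.a_group)
qed

lemma linear_maps_zero:
  assumes "f \<in> linear_maps R M N" and "module R M" and "module R N"
  shows "f \<zero>\<^bsub>M\<^esub> = \<zero>\<^bsub>N\<^esub>"
  using abelian_group_hom.hom_zero[OF linear_maps_abelian_group_hom[OF assms]] .

lemma linear_maps_minus:
  assumes "f \<in> linear_maps R M N" and "module R M" and "module R N"
    and "x \<in> carrier M" and "y \<in> carrier M"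
  shows "f (x \<ominus>\<^bsub>M\<^esub> y) = f x \<ominus>\<^bsub>N\<^esub> f y"
proof -
  interpret abelian_group_hom M N f
    using assms by (intro linear_maps_abelian_group_hom)
  show ?thesis
    using assms(4,5) by (simp add: a_minus_def)
qed

lemma linear_maps_int_pow:
  fixes k :: int
  assumes "f \<in> linear_maps R M N" and "module R M" and "module R N" and "x \<in> carrier M"
  shows "f ([k] \<cdot>\<^bsub>M\<^esub> x) = [k] \<cdot>\<^bsub>N\<^esub> f x"
proof -
  interpret abelian_group_hom M N f
    using assms by (intro linear_maps_abelian_group_hom)
  show ?thesis
    using group_hom.hom_int_pow[OF a_group_hom] assms(4) by (simp add: add_pow_def)
qed

lemma linear_maps_finsum:
  assumes "f \<in> linear_maps R M N" and "module R M" and "module R N"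
    and "finite S" and "u \<in> S \<rightarrow> carrier M"
  shows "f (\<Oplus>\<^bsub>M\<^esub>s\<in>S. u s) = (\<Oplus>\<^bsub>N\<^esub>s\<in>S. f (u s))"
proof -
  interpret M: module R M by fact
  interpret N: module R N by fact
  show ?thesis
    using assms(4,5)
  proof (induction S)
    case empty
    show ?case
      by (simp add: linear_maps_zero[OF assms(1-3)])
  next
    case (insert t S)
    then have "u t \<in> carrier M" "u \<in> S \<rightarrow> carrier M" "(\<lambda>s. f (u s)) \<in> S \<rightarrow> carrier N"
      "f (u t) \<in> carrier N"
      using linear_maps_closed[OF assms(1)] by auto
    with insert show ?case
      by (simp add: linear_maps_add[OF assms(1)])
  qed
qed

lemma linear_maps_diff:
  assumes "f \<in> linear_maps R M N" and "g \<in> linear_maps R M N" and "module R N"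
  shows "(\<lambda>x. f x \<ominus>\<^bsub>N\<^esub> g x) \<in> linear_maps R M N"
proof -
  interpret N: module R N by fact
  note f = linear_mapsD[OF assms(1)] and g = linear_mapsD[OF assms(2)]
  show ?thesis
  proof (rule linear_mapsI)
    fix x y assume x: "x \<in> carrier M" and y: "y \<in> carrier M"
    then show "f (x \<oplus>\<^bsub>M\<^esub> y) \<ominus>\<^bsub>N\<^esub> g (x \<oplus>\<^bsub>M\<^esub> y) = f x \<ominus>\<^bsub>N\<^esub> g x \<oplus>\<^bsub>N\<^esub> (f y \<ominus>\<^bsub>N\<^esub> g y)"
      by (simp add: f g a_minus_def N.minus_add N.a_ac)
  qed (simp_all add: f g a_minus_def N.smult_r_distr N.smult_r_minus)
qed

text \<open>The signs in \<open>alternating_sum\<close> act as integer multiples in the additive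
  group, not as scalars of the ring, so their compatibility with scalars has to be proved.\<close>

lemma linear_maps_scaled_int:
  fixes k :: int
  assumes "f \<in> linear_maps R M N" and "module R N"
  shows "(\<lambda>x. [k] \<cdot>\<^bsub>N\<^esub> f x) \<in> linear_maps R M N"
proof -
  interpret N: module R N by fact
  note f = linear_mapsD[OF assms(1)]
  show ?thesis
  proof (rule linear_mapsI)
    fix x y assume "x \<in> carrier M" "y \<in> carrier M"
    then show "[k] \<cdot>\<^bsub>N\<^esub> f (x \<oplus>\<^bsub>M\<^esub> y) = [k] \<cdot>\<^bsub>N\<^esub> f x \<oplus>\<^bsub>N\<^esub> [k] \<cdot>\<^bsub>N\<^esub> f y"
      by (simp add: f N.add.int_pow_distrib)
  next
    fix a x assume "a \<in> carrier R" "x \<in> carrier M"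
    \<comment> \<open>Over a commutative ring multiplication by \<open>a\<close> is a linear map, so
      it commutes with integer multiples like any other.\<close>
    moreover have "(\<lambda>x. a \<odot>\<^bsub>N\<^esub> x) \<in> linear_maps R N N" if "a \<in> carrier R" for a
      using that
      by (intro linear_mapsI)
        (simp_all add: N.smult_r_distr N.m_comm flip: N.smult_assoc1)
    ultimately show "[k] \<cdot>\<^bsub>N\<^esub> f (a \<odot>\<^bsub>M\<^esub> x) = a \<odot>\<^bsub>N\<^esub> [k] \<cdot>\<^bsub>N\<^esub> f x"
      using assms(2) by (simp add: f linear_maps_int_pow[of _ R N N])
  qed (simp add: f)
qed

lemma linear_maps_sum:
  assumes "finite S" and "\<And>s. s \<in> S \<Longrightarrow> u s \<in> linear_maps R M N" and "module R N"
  shows "(\<lambda>x. \<Oplus>\<^bsub>N\<^esub>s\<in>S. u s x) \<in> linear_maps R M N"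
proof -
  interpret N: module R N by fact
  note u = linear_mapsD[OF assms(2)]
  show ?thesis
  proof (rule linear_mapsI)
    fix x y assume x: "x \<in> carrier M" and y: "y \<in> carrier M"
    then have "(\<Oplus>\<^bsub>N\<^esub>s\<in>S. u s (x \<oplus>\<^bsub>M\<^esub> y)) = (\<Oplus>\<^bsub>N\<^esub>s\<in>S. u s x \<oplus>\<^bsub>N\<^esub> u s y)"
      by (intro N.M.finsum_cong') (auto simp: u)
    with x y show "(\<Oplus>\<^bsub>N\<^esub>s\<in>S. u s (x \<oplus>\<^bsub>M\<^esub> y)) = (\<Oplus>\<^bsub>N\<^esub>s\<in>S. u s x) \<oplus>\<^bsub>N\<^esub> (\<Oplus>\<^bsub>N\<^esub>s\<in>S. u s y)"
      by (simp add: N.M.finsum_addf u Pi_iff)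
  next
    fix a x assume a: "a \<in> carrier R" and x: "x \<in> carrier M"
    then have "(\<Oplus>\<^bsub>N\<^esub>s\<in>S. u s (a \<odot>\<^bsub>M\<^esub> x)) = (\<Oplus>\<^bsub>N\<^esub>s\<in>S. a \<odot>\<^bsub>N\<^esub> u s x)"
      by (intro N.M.finsum_cong') (auto simp: u)
    with a x show "(\<Oplus>\<^bsub>N\<^esub>s\<in>S. u s (a \<odot>\<^bsub>M\<^esub> x)) = a \<odot>\<^bsub>N\<^esub> (\<Oplus>\<^bsub>N\<^esub>s\<in>S. u s x)"
      by (simp add: N.finsum_smult_ldistr assms(1) u Pi_iff)
  qed (auto intro!: N.M.finsum_closed simp: u)
qed

text \<open>Serves the universal property: a linear map that kills the tensor relators also kills
  the submodule they generate.\<close>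

lemma kernel_submodule:
  assumes "f \<in> linear_maps R M N" and "module R M" and "module R N"
  shows "submodule {x \<in> carrier M. f x = \<zero>\<^bsub>N\<^esub>} R M"
proof -
  interpret M: module R M by fact
  interpret N: module R N by fact
  interpret abelian_group_hom M N f
    using assms by (rule linear_maps_abelian_group_hom)
  show ?thesis
    by (rule M.submoduleI) (auto simp: linear_mapsD[OF assms(1)])
qed

section \<open>Modules of homomorphisms\<close>

lemma Hom_module_carrierI:
  assumes "module R M" and "f \<in> linear_maps R M N"
  shows "restrict f (carrier M) \<in> carrier (Hom_module R M N)"
  using assms by (auto simp: Hom_module_def intro: linear_maps_cong)

lemma Hom_module_linear: "f \<in> carrier (Hom_module R M N) \<Longrightarrow> f \<in> linear_maps R M N"
  by (simp add: Hom_module_def)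

lemma Hom_module_ext:
  assumes "f \<in> carrier (Hom_module R M N)" and "g \<in> carrier (Hom_module R M N)"
    and "\<And>x. x \<in> carrier M \<Longrightarrow> f x = g x"
  shows "f = g"
  using assms by (auto simp: Hom_module_def intro: extensionalityI)

lemma Hom_module_module:
  assumes "module R M" and "module R N"
  shows "module R (Hom_module R M N)"
proof -
  interpret M: module R M by fact
  interpret N: module R N by fact
  let ?H = "Hom_module R M N"
  note D = linear_mapsD[OF Hom_module_linear[of _ R M N]]
  note eqI = Hom_module_ext[of _ R M N] and carrierI = Hom_module_carrierI[OF assms(1), of _ N]
  have zero_closed: "\<zero>\<^bsub>?H\<^esub> \<in> carrier ?H"
    using carrierI[of "\<lambda>x. \<zero>\<^bsub>N\<^esub>"] by (simp add: Hom_module_def linear_maps_def)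
  have add_closed: "f \<oplus>\<^bsub>?H\<^esub> g \<in> carrier ?H" if "f \<in> carrier ?H" "g \<in> carrier ?H" for f g
  proof -
    have "(\<lambda>x. f x \<oplus>\<^bsub>N\<^esub> g x) \<in> linear_maps R M N"
      by (rule linear_mapsI) (simp_all add: that D N.smult_r_distr N.M.a_ac)
    from carrierI[OF this] show ?thesis
      by (simp add: Hom_module_def)
  qed
  have smult_closed: "a \<odot>\<^bsub>?H\<^esub> f \<in> carrier ?H" if "a \<in> carrier R" "f \<in> carrier ?H" for a f
  proof -
    have "(\<lambda>x. a \<odot>\<^bsub>N\<^esub> f x) \<in> linear_maps R M N"
      by (rule linear_mapsI)
        (simp_all add: that D N.smult_r_distr M.m_comm flip: N.smult_assoc1)
    from carrierI[OF this] show ?thesis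
      by (simp add: Hom_module_def)
  qed
  have val:
    "(f \<oplus>\<^bsub>?H\<^esub> g) x = f x \<oplus>\<^bsub>N\<^esub> g x" "\<zero>\<^bsub>?H\<^esub> x = \<zero>\<^bsub>N\<^esub>" "(a \<odot>\<^bsub>?H\<^esub> f) x = a \<odot>\<^bsub>N\<^esub> f x"
    if "x \<in> carrier M" for f g x a
    using that by (simp_all add: Hom_module_def)
  note closed = zero_closed add_closed smult_closed
  show ?thesis
  proof (rule moduleI)
    show "abelian_group ?H"
    proof (rule abelian_groupI)
      fix f assume f: "f \<in> carrier ?H"
      \<comment> \<open>The negative of \<open>f\<close> is written as zero minus \<open>f\<close>,
        so that closure of linear maps under differences applies.\<close>
      have "(\<lambda>x. \<zero>\<^bsub>N\<^esub>) \<in> linear_maps R M N"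
        by (rule linear_mapsI) simp_all
      from linear_maps_diff[OF this Hom_module_linear[OF f] assms(2)]
      have n: "(\<lambda>x\<in>carrier M. \<zero>\<^bsub>N\<^esub> \<ominus>\<^bsub>N\<^esub> f x) \<in> carrier ?H"
        by (rule carrierI)
      have "(\<lambda>x\<in>carrier M. \<zero>\<^bsub>N\<^esub> \<ominus>\<^bsub>N\<^esub> f x) \<oplus>\<^bsub>?H\<^esub> f = \<zero>\<^bsub>?H\<^esub>"
        by (intro eqI closed n f) (simp add: val D f a_minus_def N.M.l_neg)
      with n show "\<exists>g\<in>carrier ?H. g \<oplus>\<^bsub>?H\<^esub> f = \<zero>\<^bsub>?H\<^esub>"
        by blast
    qed (auto intro!: eqI closed simp: val D N.M.a_ac)
  qed (auto intro!: eqI closed M.R.cring_axioms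
      simp: val D N.smult_r_distr N.smult_l_distr N.smult_assoc1)
qed

text \<open>Operations in the module of homomorphisms are pointwise. Through this map sums,
  differences and signed sums of convolution products are computed in the target algebra.\<close>

lemma Hom_module_eval:
  assumes "x \<in> carrier M"
  shows "(\<lambda>f. f x) \<in> linear_maps R (Hom_module R M N) N"
  using assms by (auto simp: Hom_module_def linear_maps_def)

text \<open>For the same reason linear dependence on a parameter \<open>k\<close> can be tested at
  each point \<open>x\<close> separately. This gives the bilinearity behind \<open>lambda2\<close>
  and the linearity of \<open>convolution\<close>.\<close>

lemma linear_maps_into_Hom_moduleI:
  assumes "\<And>k. k \<in> carrier K \<Longrightarrow> restrict (u k) (carrier M) \<in> carrier (Hom_module R M N)"
    and "\<And>x. x \<in> carrier M \<Longrightarrow> (\<lambda>k. u k x) \<in> linear_maps R K N"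
  shows "(\<lambda>k. restrict (u k) (carrier M)) \<in> linear_maps R K (Hom_module R M N)"
proof -
  note u = linear_mapsD[OF assms(2)]
  show ?thesis
  proof (rule linear_mapsI)
    fix a k assume "a \<in> carrier R" "k \<in> carrier K"
    then show "restrict (u (a \<odot>\<^bsub>K\<^esub> k)) (carrier M) = a \<odot>\<^bsub>Hom_module R M N\<^esub> restrict (u k) (carrier M)"
      by (auto simp: Hom_module_def u)
  next
    fix k l assume "k \<in> carrier K" "l \<in> carrier K"
    then show "restrict (u (k \<oplus>\<^bsub>K\<^esub> l)) (carrier M)
      = restrict (u k) (carrier M) \<oplus>\<^bsub>Hom_module R M N\<^esub> restrict (u l) (carrier M)"
      by (auto simp: Hom_module_def u)
  qed (rule assms(1))
qed

section \<open>Free modules and quotients\<close>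

lemma free_module_module:
  assumes "cring R"
  shows "module R (free_module R S)"
proof -
  interpret R: cring R by fact
  let ?F = "free_module R S"
  have closed: "\<phi> s \<in> carrier R" if "\<phi> \<in> carrier ?F" for \<phi> s
    using that by (simp add: free_module_def)
  \<comment> \<open>Any finite set containing the support suffices: cancellation and zero divisors
    can make the support of a sum or a multiple smaller than the obvious bound.\<close>
  have carrierI: "\<phi> \<in> carrier ?F"
    if "\<And>s. \<phi> s \<in> carrier R" "finite T" "T \<subseteq> S" "\<And>s. s \<notin> T \<Longrightarrow> \<phi> s = \<zero>\<^bsub>R\<^esub>" for \<phi> T
  proof -
    have "{s. \<phi> s \<noteq> \<zero>\<^bsub>R\<^esub>} \<subseteq> T"
      using that(4) by auto
    with that show ?thesis
      by (auto simp: free_module_def intro: finite_subset)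
  qed
  have support: "finite {s. \<phi> s \<noteq> \<zero>\<^bsub>R\<^esub>}" "{s. \<phi> s \<noteq> \<zero>\<^bsub>R\<^esub>} \<subseteq> S" if "\<phi> \<in> carrier ?F" for \<phi>
    using that by (auto simp: free_module_def)
  have val: "(\<phi> \<oplus>\<^bsub>?F\<^esub> \<psi>) = (\<lambda>s. \<phi> s \<oplus>\<^bsub>R\<^esub> \<psi> s)" "\<zero>\<^bsub>?F\<^esub> = (\<lambda>s. \<zero>\<^bsub>R\<^esub>)"
    "(a \<odot>\<^bsub>?F\<^esub> \<phi>) = (\<lambda>s. a \<otimes>\<^bsub>R\<^esub> \<phi> s)" for \<phi> \<psi> a
    by (simp_all add: free_module_def)
  have add_closed: "\<phi> \<oplus>\<^bsub>?F\<^esub> \<psi> \<in> carrier ?F" if "\<phi> \<in> carrier ?F" "\<psi> \<in> carrier ?F" for \<phi> \<psi>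
    by (rule carrierI[of _ "{s. \<phi> s \<noteq> \<zero>\<^bsub>R\<^esub>} \<union> {s. \<psi> s \<noteq> \<zero>\<^bsub>R\<^esub>}"])
      (use that support in \<open>auto simp: val closed\<close>)
  have smult_closed: "a \<odot>\<^bsub>?F\<^esub> \<phi> \<in> carrier ?F" if "a \<in> carrier R" "\<phi> \<in> carrier ?F" for a \<phi>
    by (rule carrierI[of _ "{s. \<phi> s \<noteq> \<zero>\<^bsub>R\<^esub>}"])
      (use that support in \<open>auto simp: val closed\<close>)
  have zero_closed: "\<zero>\<^bsub>?F\<^esub> \<in> carrier ?F"
    by (simp add: free_module_def)
  have neg: "\<exists>\<psi>\<in>carrier ?F. \<psi> \<oplus>\<^bsub>?F\<^esub> \<phi> = \<zero>\<^bsub>?F\<^esub>" if "\<phi> \<in> carrier ?F" for \<phi>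
  proof
    show "(\<lambda>s. \<ominus>\<^bsub>R\<^esub> \<phi> s) \<in> carrier ?F"
      by (rule carrierI[of _ "{s. \<phi> s \<noteq> \<zero>\<^bsub>R\<^esub>}"])
        (use that support in \<open>auto simp: val closed\<close>)
    show "(\<lambda>s. \<ominus>\<^bsub>R\<^esub> \<phi> s) \<oplus>\<^bsub>?F\<^esub> \<phi> = \<zero>\<^bsub>?F\<^esub>"
      using that by (simp add: val closed R.l_neg)
  qed
  note closeds = add_closed smult_closed zero_closed
  show ?thesis
  proof (rule moduleI)
    show "abelian_group ?F"
      by (rule abelian_groupI) (use closeds neg in \<open>auto simp: val closed R.a_ac\<close>)
  qed (use closeds in \<open>auto simp: val closed R.l_distr R.r_distr R.m_assoc R.is_cring\<close>)
qed

lemma free_basis_closed: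
  assumes "cring R" and "s \<in> S"
  shows "free_basis R s \<in> carrier (free_module R S)"
proof -
  interpret R: cring R by fact
  have "{t. free_basis R s t \<noteq> \<zero>\<^bsub>R\<^esub>} \<subseteq> {s}"
    by (auto simp: free_basis_def)
  moreover from this have "finite {t. free_basis R s t \<noteq> \<zero>\<^bsub>R\<^esub>}"
    by (rule finite_subset) simp
  ultimately show ?thesis
    using assms(2) by (auto simp: free_module_def free_basis_def)
qed

text \<open>Induction on a finite set \<open>T\<close> containing the support. Setting the
  coefficient at one point \<open>t\<close> to zero leaves a function supported in the rest, and a
  multiple of the basis element at \<open>t\<close> restores it; whether \<open>\<phi> t\<close>
  vanishes makes no difference.\<close>

lemma free_module_induct [consumes 2, case_names zero basis add smult]:
  assumes "cring R" and "\<phi> \<in> carrier (free_module R S)"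
    and zero: "P \<zero>\<^bsub>free_module R S\<^esub>"
    and basis: "\<And>s. s \<in> S \<Longrightarrow> P (free_basis R s)"
    and add: "\<And>\<phi> \<psi>. \<phi> \<in> carrier (free_module R S) \<Longrightarrow> \<psi> \<in> carrier (free_module R S)
      \<Longrightarrow> P \<phi> \<Longrightarrow> P \<psi> \<Longrightarrow> P (\<phi> \<oplus>\<^bsub>free_module R S\<^esub> \<psi>)"
    and smult: "\<And>a \<phi>. a \<in> carrier R \<Longrightarrow> \<phi> \<in> carrier (free_module R S)
      \<Longrightarrow> P \<phi> \<Longrightarrow> P (a \<odot>\<^bsub>free_module R S\<^esub> \<phi>)"
  shows "P \<phi>"
proof -
  interpret R: cring R by fact
  let ?F = "free_module R S"
  interpret F: module R ?F
    using assms(1) by (rule free_module_module)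
  have "P \<phi>" if "finite T" "T \<subseteq> S" "\<phi> \<in> carrier ?F" "{s. \<phi> s \<noteq> \<zero>\<^bsub>R\<^esub>} \<subseteq> T" for T \<phi>
    using that
  proof (induction T arbitrary: \<phi>)
    case empty
    then have "\<phi> = \<zero>\<^bsub>?F\<^esub>"
      by (auto simp: free_module_def)
    with zero show ?case
      by simp
  next
    case (insert t T)
    let ?\<psi> = "\<phi>(t := \<zero>\<^bsub>R\<^esub>)"
    have coeff: "\<phi> s \<in> carrier R" for s
      using insert.prems by (simp add: free_module_def)
    have sub: "{s. ?\<psi> s \<noteq> \<zero>\<^bsub>R\<^esub>} \<subseteq> T"
      using insert.prems by auto
    moreover have "finite {s. ?\<psi> s \<noteq> \<zero>\<^bsub>R\<^esub>}"
      using sub insert.hyps(1) by (rule finite_subset)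
    ultimately have \<psi>: "?\<psi> \<in> carrier ?F"
      using insert.prems by (auto simp: free_module_def)
    have e: "free_basis R t \<in> carrier ?F"
      using insert.prems assms(1) by (intro free_basis_closed) auto
    have "\<phi> = ?\<psi> \<oplus>\<^bsub>?F\<^esub> \<phi> t \<odot>\<^bsub>?F\<^esub> free_basis R t"
      using coeff by (auto simp: free_module_def free_basis_def fun_eq_iff)
    moreover have "P (?\<psi> \<oplus>\<^bsub>?F\<^esub> \<phi> t \<odot>\<^bsub>?F\<^esub> free_basis R t)"
      using insert.IH[OF _ \<psi> sub] insert.prems
      by (intro add smult basis \<psi> e coeff F.smult_closed) (auto simp: fun_upd_def)
    ultimately show ?case
      by simp
  qed
  with assms(2) show ?thesis
    by (auto simp: free_module_def)
qed

text \<open>The linear extension of \<open>b\<close>. For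
  \<open>b s = \<beta> (fst s) (snd s)\<close> it is the function that \<open>tensor_lift\<close>
  evaluates on the members of a coset.\<close>

definition free_lift ::
  "('r, 'p) ring_scheme \<Rightarrow> ('r, 'k, 'q) module_scheme \<Rightarrow> ('s \<Rightarrow> 'k) \<Rightarrow> ('s \<Rightarrow> 'r) \<Rightarrow> 'k"
  where "free_lift R P b \<phi> = (\<Oplus>\<^bsub>P\<^esub>s\<in>{s. \<phi> s \<noteq> \<zero>\<^bsub>R\<^esub>}. \<phi> s \<odot>\<^bsub>P\<^esub> b s)"

text \<open>Indices outside the support contribute zero. This lets functions with different supports
  be summed over a common index set, which is what additivity of \<open>free_lift\<close>
  requires.\<close>

lemma free_lift_eq_sum:
  assumes "module R P" and "b \<in> S \<rightarrow> carrier P" and "\<phi> \<in> carrier (free_module R S)"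
    and "finite T" and "{s. \<phi> s \<noteq> \<zero>\<^bsub>R\<^esub>} \<subseteq> T" and "T \<subseteq> S"
  shows "free_lift R P b \<phi> = (\<Oplus>\<^bsub>P\<^esub>s\<in>T. \<phi> s \<odot>\<^bsub>P\<^esub> b s)"
proof -
  interpret P: module R P by fact
  have "\<phi> s \<in> carrier R" for s
    using assms(3) by (simp add: free_module_def)
  then show ?thesis
    unfolding free_lift_def
    by (intro P.M.add.finprod_mono_neutral_cong_left) (use assms in \<open>auto simp: Pi_iff\<close>)
qed

lemma free_lift_linear:
  assumes "module R P" and "b \<in> S \<rightarrow> carrier P"
  shows "free_lift R P b \<in> linear_maps R (free_module R S) P"
proof -
  interpret P: module R P by fact
  let ?F = "free_module R S"
  interpret F: module R ?F
    by (rule free_module_module) (rule P.R.cring_axioms)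
  let ?supp = "\<lambda>\<phi>. {s. \<phi> s \<noteq> \<zero>\<^bsub>R\<^esub>}"
  have b: "b s \<in> carrier P" if "s \<in> S" for s
    using that assms(2) by auto
  have coeff: "\<phi> s \<in> carrier R" and supp: "finite (?supp \<phi>)" "?supp \<phi> \<subseteq> S" if "\<phi> \<in> carrier ?F" for \<phi> s
    using that by (auto simp: free_module_def)
  note sum = free_lift_eq_sum[OF assms]
  show ?thesis
  proof (rule linear_mapsI)
    fix \<phi> assume \<phi>: "\<phi> \<in> carrier ?F"
    then show "free_lift R P b \<phi> \<in> carrier P"
      unfolding free_lift_def
      using supp[OF \<phi>] by (auto intro!: P.M.finsum_closed simp: coeff b subset_eq)
  next
    fix \<phi> \<psi> assume \<phi>: "\<phi> \<in> carrier ?F" and \<psi>: "\<psi> \<in> carrier ?F"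
    let ?T = "?supp \<phi> \<union> ?supp \<psi>"
    have T: "finite ?T" "?T \<subseteq> S"
      using supp[OF \<phi>] supp[OF \<psi>] by auto
    have add: "(\<phi> \<oplus>\<^bsub>?F\<^esub> \<psi>) s = \<phi> s \<oplus>\<^bsub>R\<^esub> \<psi> s" for s
      by (simp add: free_module_def)
    have "?supp (\<phi> \<oplus>\<^bsub>?F\<^esub> \<psi>) \<subseteq> ?T"
      by (auto simp: add)
    with T \<phi> \<psi> have "free_lift R P b (\<phi> \<oplus>\<^bsub>?F\<^esub> \<psi>) = (\<Oplus>\<^bsub>P\<^esub>s\<in>?T. (\<phi> \<oplus>\<^bsub>?F\<^esub> \<psi>) s \<odot>\<^bsub>P\<^esub> b s)"
      by (intro sum) auto
    also have "\<dots> = (\<Oplus>\<^bsub>P\<^esub>s\<in>?T. \<phi> s \<odot>\<^bsub>P\<^esub> b s \<oplus>\<^bsub>P\<^esub> \<psi> s \<odot>\<^bsub>P\<^esub> b s)"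
      using T(2) by (intro P.M.finsum_cong')
        (auto simp: add P.smult_l_distr coeff[OF \<phi>] coeff[OF \<psi>] b subset_eq)
    also have "\<dots> = (\<Oplus>\<^bsub>P\<^esub>s\<in>?T. \<phi> s \<odot>\<^bsub>P\<^esub> b s) \<oplus>\<^bsub>P\<^esub> (\<Oplus>\<^bsub>P\<^esub>s\<in>?T. \<psi> s \<odot>\<^bsub>P\<^esub> b s)"
      using T(2) by (intro P.M.finsum_addf) (auto simp: coeff[OF \<phi>] coeff[OF \<psi>] b subset_eq)
    also have "\<dots> = free_lift R P b \<phi> \<oplus>\<^bsub>P\<^esub> free_lift R P b \<psi>"
      using T \<phi> \<psi> by (simp add: sum[of \<phi> ?T] sum[of \<psi> ?T])
    finally show "free_lift R P b (\<phi> \<oplus>\<^bsub>?F\<^esub> \<psi>) = free_lift R P b \<phi> \<oplus>\<^bsub>P\<^esub> free_lift R P b \<psi>" .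
  next
    fix a \<phi> assume a: "a \<in> carrier R" and \<phi>: "\<phi> \<in> carrier ?F"
    have val: "(a \<odot>\<^bsub>?F\<^esub> \<phi>) s = a \<otimes>\<^bsub>R\<^esub> \<phi> s" for s
      by (simp add: free_module_def)
    have "?supp (a \<odot>\<^bsub>?F\<^esub> \<phi>) \<subseteq> ?supp \<phi>"
      using a by (auto simp: val)
    with a \<phi> supp[OF \<phi>] have "free_lift R P b (a \<odot>\<^bsub>?F\<^esub> \<phi>) = (\<Oplus>\<^bsub>P\<^esub>s\<in>?supp \<phi>. (a \<odot>\<^bsub>?F\<^esub> \<phi>) s \<odot>\<^bsub>P\<^esub> b s)"
      by (intro sum) auto
    also have "\<dots> = (\<Oplus>\<^bsub>P\<^esub>s\<in>?supp \<phi>. a \<odot>\<^bsub>P\<^esub> (\<phi> s \<odot>\<^bsub>P\<^esub> b s))"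
      using supp(2)[OF \<phi>] a by (intro P.M.finsum_cong')
        (auto simp: val P.smult_assoc1 coeff[OF \<phi>] b subset_eq)
    also have "\<dots> = a \<odot>\<^bsub>P\<^esub> free_lift R P b \<phi>"
      unfolding free_lift_def using supp[OF \<phi>] a
      by (intro P.finsum_smult_ldistr[symmetric]) (auto simp: coeff[OF \<phi>] b subset_eq)
    finally show "free_lift R P b (a \<odot>\<^bsub>?F\<^esub> \<phi>) = a \<odot>\<^bsub>P\<^esub> free_lift R P b \<phi>" .
  qed
qed

lemma free_lift_basis:
  assumes "module R P" and "b \<in> S \<rightarrow> carrier P" and "s \<in> S"
  shows "free_lift R P b (free_basis R s) = b s"
proof -
  interpret P: module R P by fact
  have b: "b s \<in> carrier P"
    using assms by auto
  have "free_lift R P b (free_basis R s) = (\<Oplus>\<^bsub>P\<^esub>t\<in>{s}. free_basis R s t \<odot>\<^bsub>P\<^esub> b t)"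
    using assms by (intro free_lift_eq_sum free_basis_closed P.R.cring_axioms)
      (auto simp: free_basis_def)
  also have "\<dots> = b s"
    using b by (simp add: free_basis_def)
  finally show ?thesis .
qed

section \<open>Quotients by submodules\<close>

lemma submodule_abelian_subgroup:
  assumes "module R M" and "submodule K R M"
  shows "abelian_subgroup K M"
proof -
  interpret M: module R M by fact
  show ?thesis
    using submodule.axioms(1)[OF assms(2)]
    by (intro abelian_subgroupI3 additive_subgroupI M.abelian_group_axioms)
qed

lemma quotient_module_carrier:
  "carrier (quotient_module M K) = {K +>\<^bsub>M\<^esub> x |x. x \<in> carrier M}"
  by (auto simp: quotient_module_def A_RCOSETS_def' a_r_coset_def')

lemma quotient_module_add:
  assumes "module R M" and "submodule K R M" and "x \<in> carrier M" and "y \<in> carrier M"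
  shows "(K +>\<^bsub>M\<^esub> x) \<oplus>\<^bsub>quotient_module M K\<^esub> (K +>\<^bsub>M\<^esub> y) = K +>\<^bsub>M\<^esub> (x \<oplus>\<^bsub>M\<^esub> y)"
  using abelian_subgroup.a_rcos_sum[OF submodule_abelian_subgroup] assms
  by (simp add: quotient_module_def)

text \<open>If \<open>y\<close> lies in the coset of \<open>x\<close>, then \<open>y - x\<close> and
  hence \<open>a(y - x)\<close> lie in \<open>K\<close>. So all cosets in the union that defines the
  scalar action coincide.\<close>

lemma quotient_module_smult:
  assumes "module R M" and "submodule K R M" and "a \<in> carrier R" and "x \<in> carrier M"
  shows "a \<odot>\<^bsub>quotient_module M K\<^esub> (K +>\<^bsub>M\<^esub> x) = K +>\<^bsub>M\<^esub> (a \<odot>\<^bsub>M\<^esub> x)"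
proof -
  interpret M: module R M by fact
  interpret K: abelian_subgroup K M
    using assms(1,2) by (rule submodule_abelian_subgroup)
  have "K +>\<^bsub>M\<^esub> (a \<odot>\<^bsub>M\<^esub> y) = K +>\<^bsub>M\<^esub> (a \<odot>\<^bsub>M\<^esub> x)" if "y \<in> K +>\<^bsub>M\<^esub> x" for y
  proof -
    have y: "y \<in> carrier M"
      using K.a_elemrcos_carrier[OF assms(4) that] .
    have "y \<oplus>\<^bsub>M\<^esub> \<ominus>\<^bsub>M\<^esub> x \<in> K"
      using K.a_rcos_module_imp[OF assms(4) that] .
    then have "a \<odot>\<^bsub>M\<^esub> (y \<oplus>\<^bsub>M\<^esub> \<ominus>\<^bsub>M\<^esub> x) \<in> K"
      using assms(2,3) by (simp add: submodule.smult_closed)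
    then have "a \<odot>\<^bsub>M\<^esub> y \<oplus>\<^bsub>M\<^esub> \<ominus>\<^bsub>M\<^esub> (a \<odot>\<^bsub>M\<^esub> x) \<in> K"
      using assms(3,4) y by (simp add: M.smult_r_distr M.smult_r_minus)
    then have "a \<odot>\<^bsub>M\<^esub> y \<in> K +>\<^bsub>M\<^esub> (a \<odot>\<^bsub>M\<^esub> x)"
      using assms(3,4) y by (simp add: K.a_rcos_module)
    then show ?thesis
      using K.a_repr_independence' assms(3,4) by simp
  qed
  moreover have "x \<in> K +>\<^bsub>M\<^esub> x"
    using assms(4) by (rule K.a_rcos_self)
  ultimately have "(\<Union>y\<in>K +>\<^bsub>M\<^esub> x. K +>\<^bsub>M\<^esub> (a \<odot>\<^bsub>M\<^esub> y)) = K +>\<^bsub>M\<^esub> (a \<odot>\<^bsub>M\<^esub> x)"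
    by (intro UN_constant_eq ballI)
  then show ?thesis
    by (simp add: quotient_module_def)
qed

lemma quotient_module_module:
  assumes "module R M" and "submodule K R M"
  shows "module R (quotient_module M K)"
proof -
  interpret M: module R M by fact
  interpret K: abelian_subgroup K M
    using assms by (rule submodule_abelian_subgroup)
  let ?Q = "quotient_module M K"
  have carrierE: "\<exists>x\<in>carrier M. X = K +>\<^bsub>M\<^esub> x" if "X \<in> carrier ?Q" for X
    using that by (auto simp: quotient_module_carrier)
  have carrierI: "K +>\<^bsub>M\<^esub> x \<in> carrier ?Q" if "x \<in> carrier M" for x
    using that by (auto simp: quotient_module_carrier)
  have zero: "\<zero>\<^bsub>?Q\<^esub> = K +>\<^bsub>M\<^esub> \<zero>\<^bsub>M\<^esub>"
    by (simp add: quotient_module_def K.a_rcos_const)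
  note ops = quotient_module_add[OF assms] quotient_module_smult[OF assms] zero
  have neg: "\<exists>Y\<in>carrier ?Q. Y \<oplus>\<^bsub>?Q\<^esub> X = \<zero>\<^bsub>?Q\<^esub>" if X: "X \<in> carrier ?Q" for X
  proof -
    obtain x where x: "x \<in> carrier M" "X = K +>\<^bsub>M\<^esub> x"
      using carrierE[OF X] by blast
    then have "(K +>\<^bsub>M\<^esub> (\<ominus>\<^bsub>M\<^esub> x)) \<oplus>\<^bsub>?Q\<^esub> X = \<zero>\<^bsub>?Q\<^esub>"
      by (simp add: ops M.l_neg)
    with x(1) show ?thesis
      by (intro bexI[of _ "K +>\<^bsub>M\<^esub> (\<ominus>\<^bsub>M\<^esub> x)"] carrierI) auto
  qed
  show ?thesis
  proof (rule moduleI)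
    show "abelian_group ?Q"
      \<comment> \<open>The sixth premise of \<open>abelian_groupI\<close> is the existence of
        negatives.\<close>
      by (rule abelian_groupI, erule_tac [6] neg)
        (auto dest!: carrierE simp: carrierI ops M.a_ac)
  qed (auto dest!: carrierE simp: carrierI ops M.smult_l_distr M.smult_r_distr
      M.smult_assoc1 M.R.cring_axioms)
qed

lemma quotient_projection_linear:
  assumes "module R M" and "submodule K R M"
  shows "(\<lambda>x. K +>\<^bsub>M\<^esub> x) \<in> linear_maps R M (quotient_module M K)"
  using quotient_module_add[OF assms] quotient_module_smult[OF assms]
  by (intro linear_mapsI) (auto simp: quotient_module_carrier)

text \<open>Members of one coset differ by elements of \<open>K\<close>, so the image of the coset
  is a singleton. This is what gives \<open>the_elem\<close> in \<open>tensor_lift\<close> its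
  meaning.\<close>

lemma quotient_lift:
  assumes "module R M" and "submodule K R M" and "module R P" and "f \<in> linear_maps R M P"
    and vanish: "\<And>k. k \<in> K \<Longrightarrow> f k = \<zero>\<^bsub>P\<^esub>" and "x \<in> carrier M"
  shows "the_elem (f ` (K +>\<^bsub>M\<^esub> x)) = f x"
proof -
  interpret M: module R M by fact
  interpret P: module R P by fact
  interpret K: abelian_subgroup K M
    using assms(1,2) by (rule submodule_abelian_subgroup)
  note f = linear_mapsD[OF assms(4)]
  have const: "f y = f x" if "y \<in> K +>\<^bsub>M\<^esub> x" for y
    using that assms(6) by (auto simp: a_r_coset_def' f vanish)
  have "f ` (K +>\<^bsub>M\<^esub> x) \<subseteq> {f x}"
    by (rule image_subsetI) (simp only: singleton_iff const)
  moreover have "f x \<in> f ` (K +>\<^bsub>M\<^esub> x)"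
    using assms(6) by (intro imageI K.a_rcos_self)
  ultimately have "f ` (K +>\<^bsub>M\<^esub> x) = {f x}"
    by blast
  then show ?thesis
    by simp
qed

section \<open>The universal property of the tensor product\<close>

definition bilinear_maps ::
  "('r, 'p) ring_scheme \<Rightarrow> ('r, 'm, 'q) module_scheme \<Rightarrow> ('r, 'n, 's) module_scheme
    \<Rightarrow> ('r, 'k, 't) module_scheme \<Rightarrow> ('m \<Rightarrow> 'n \<Rightarrow> 'k) set"
  where "bilinear_maps R M N P =
    {\<beta>. (\<forall>x\<in>carrier M. \<beta> x \<in> linear_maps R N P) \<and> (\<forall>y\<in>carrier N. (\<lambda>x. \<beta> x y) \<in> linear_maps R M P)}"

text \<open>Curried to match the bracketing of \<open>tensor_cube\<close>: with the first argument
  fixed, the rest is a bilinear map that lifts to the inner tensor square.\<close>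

definition trilinear_maps ::
  "('r, 'p) ring_scheme \<Rightarrow> ('r, 'm, 'q) module_scheme \<Rightarrow> ('r, 'k, 't) module_scheme
    \<Rightarrow> ('m \<Rightarrow> 'm \<Rightarrow> 'm \<Rightarrow> 'k) set"
  where "trilinear_maps R M P =
    {\<gamma>. (\<forall>x\<in>carrier M. \<gamma> x \<in> bilinear_maps R M M P) \<and>
      (\<forall>y\<in>carrier M. \<forall>z\<in>carrier M. (\<lambda>x. \<gamma> x y z) \<in> linear_maps R M P)}"

lemma bilinear_mapsI:
  assumes "\<And>x. x \<in> carrier M \<Longrightarrow> \<beta> x \<in> linear_maps R N P"
    and "\<And>y. y \<in> carrier N \<Longrightarrow> (\<lambda>x. \<beta> x y) \<in> linear_maps R M P"
  shows "\<beta> \<in> bilinear_maps R M N P"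
  using assms by (simp add: bilinear_maps_def)

lemma bilinear_mapsD:
  assumes "\<beta> \<in> bilinear_maps R M N P"
  shows "x \<in> carrier M \<Longrightarrow> \<beta> x \<in> linear_maps R N P"
    and "y \<in> carrier N \<Longrightarrow> (\<lambda>x. \<beta> x y) \<in> linear_maps R M P"
  using assms by (simp_all add: bilinear_maps_def)

lemma trilinear_mapsD:
  assumes "\<gamma> \<in> trilinear_maps R M P"
  shows "x \<in> carrier M \<Longrightarrow> \<gamma> x \<in> bilinear_maps R M M P"
    and "y \<in> carrier M \<Longrightarrow> z \<in> carrier M \<Longrightarrow> (\<lambda>x. \<gamma> x y z) \<in> linear_maps R M P"
  using assms by (simp_all add: trilinear_maps_def)

lemma trilinear_mapsI:
  assumes "\<And>y z. y \<in> carrier M \<Longrightarrow> z \<in> carrier M \<Longrightarrow> (\<lambda>x. \<gamma> x y z) \<in> linear_maps R M P"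
    and "\<And>x z. x \<in> carrier M \<Longrightarrow> z \<in> carrier M \<Longrightarrow> (\<lambda>y. \<gamma> x y z) \<in> linear_maps R M P"
    and "\<And>x y. x \<in> carrier M \<Longrightarrow> y \<in> carrier M \<Longrightarrow> \<gamma> x y \<in> linear_maps R M P"
  shows "\<gamma> \<in> trilinear_maps R M P"
  using assms by (simp add: trilinear_maps_def bilinear_maps_def)

lemma tensor_relators_closed:
  assumes "module R M" and "module R N"
  shows "tensor_relators R M N \<subseteq> carrier (free_module R (carrier M \<times> carrier N))"
proof -
  interpret M: module R M by fact
  interpret N: module R N by fact
  let ?F = "free_module R (carrier M \<times> carrier N)"
  interpret F: module R ?F
    by (rule free_module_module) (rule M.R.cring_axioms)
  have "free_basis R (x, y) \<in> carrier ?F" if "x \<in> carrier M" "y \<in> carrier N" for x y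
    using that by (intro free_basis_closed M.R.cring_axioms) simp
  then show ?thesis
    by (auto simp: tensor_relators_def Let_def)
qed

text \<open>\<open>hull\<close> is an intersection, and submodules are closed under intersections.
  The whole free module is one of the sets intersected, because it contains the relators; this
  bounds the result by the carrier.\<close>

lemma tensor_kernel_submodule:
  assumes "module R M" and "module R N"
  shows "submodule (tensor_kernel R M N) R (free_module R (carrier M \<times> carrier N))"
proof -
  interpret M: module R M by fact
  let ?F = "free_module R (carrier M \<times> carrier N)"
  interpret F: module R ?F
    by (rule free_module_module) (rule M.R.cring_axioms)
  have zero: "\<zero>\<^bsub>?F\<^esub> \<in> H" if "submodule H R ?F" for H
    using subgroup.one_closed[OF submodule.axioms(1)[OF that]] by simp
  note E = F.submoduleE zero
  show ?thesis
    unfolding tensor_kernel_def hull_def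
  proof (rule F.submoduleI)
    show "\<Inter>{H. submodule H R ?F \<and> tensor_relators R M N \<subseteq> H} \<subseteq> carrier ?F"
      using F.carrier_is_submodule tensor_relators_closed[OF assms] by (intro Inter_lower) simp
  qed (simp_all add: E)
qed

lemma tensor_module:
  assumes "module R M" and "module R N"
  shows "module R (tensor R M N)"
  unfolding tensor_def
  using assms
  by (intro quotient_module_module free_module_module tensor_kernel_submodule) (simp add: module_def)

text \<open>Each family of relators consists of the differences that one law of bilinearity requires
  to vanish, so the two representatives lie in the same coset (\<open>coset_eq\<close>).\<close>

lemma tens_bilinear:
  assumes "module R M" and "module R N"
  shows "tens R M N \<in> bilinear_maps R M N (tensor R M N)"
proof -
  interpret M: module R M by fact
  interpret N: module R N by fact
  let ?F = "free_module R (carrier M \<times> carrier N)"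
  let ?K = "tensor_kernel R M N"
  let ?e = "\<lambda>x y. free_basis R (x, y)"
  have F: "module R ?F"
    by (rule free_module_module) (rule M.R.cring_axioms)
  interpret F: module R ?F
    by (rule F)
  have K: "submodule ?K R ?F"
    using assms by (rule tensor_kernel_submodule)
  interpret K: abelian_subgroup ?K ?F
    using F K by (rule submodule_abelian_subgroup)
  have e: "?e x y \<in> carrier ?F" if "x \<in> carrier M" "y \<in> carrier N" for x y
    using that by (intro free_basis_closed M.R.cring_axioms) simp
  have coset_eq: "?K +>\<^bsub>?F\<^esub> u = ?K +>\<^bsub>?F\<^esub> v"
    if "u \<ominus>\<^bsub>?F\<^esub> v \<in> tensor_relators R M N" "u \<in> carrier ?F" "v \<in> carrier ?F" for u v
  proof -
    have "u \<oplus>\<^bsub>?F\<^esub> \<ominus>\<^bsub>?F\<^esub> v \<in> ?K"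
      using that(1) by (simp add: tensor_kernel_def a_minus_def hull_inc)
    then have "u \<in> ?K +>\<^bsub>?F\<^esub> v"
      using that by (simp add: K.a_rcos_module)
    then show ?thesis
      using K.a_repr_independence' that(3) by simp
  qed
  note proj = linear_mapsD[OF quotient_projection_linear[OF F K], folded tensor_def]
  show ?thesis
    unfolding tens_def
  proof (intro bilinear_mapsI linear_mapsI)
    fix x y assume xy: "x \<in> carrier M" "y \<in> carrier N"
    fix a assume a: "a \<in> carrier R"
    have "?e x (a \<odot>\<^bsub>N\<^esub> y) \<ominus>\<^bsub>?F\<^esub> (a \<odot>\<^bsub>?F\<^esub> ?e x y) \<in> tensor_relators R M N"
      unfolding tensor_relators_def Let_def using a xy by blast
    then have "?K +>\<^bsub>?F\<^esub> ?e x (a \<odot>\<^bsub>N\<^esub> y) = ?K +>\<^bsub>?F\<^esub> (a \<odot>\<^bsub>?F\<^esub> ?e x y)"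
      using a xy by (intro coset_eq e F.smult_closed) simp_all
    then show "?K +>\<^bsub>?F\<^esub> ?e x (a \<odot>\<^bsub>N\<^esub> y) = a \<odot>\<^bsub>tensor R M N\<^esub> (?K +>\<^bsub>?F\<^esub> ?e x y)"
      using a xy by (simp add: proj e)
    have "?e (a \<odot>\<^bsub>M\<^esub> x) y \<ominus>\<^bsub>?F\<^esub> (a \<odot>\<^bsub>?F\<^esub> ?e x y) \<in> tensor_relators R M N"
      unfolding tensor_relators_def Let_def using a xy by blast
    then have "?K +>\<^bsub>?F\<^esub> ?e (a \<odot>\<^bsub>M\<^esub> x) y = ?K +>\<^bsub>?F\<^esub> (a \<odot>\<^bsub>?F\<^esub> ?e x y)"
      using a xy by (intro coset_eq e F.smult_closed) simp_all
    then show "?K +>\<^bsub>?F\<^esub> ?e (a \<odot>\<^bsub>M\<^esub> x) y = a \<odot>\<^bsub>tensor R M N\<^esub> (?K +>\<^bsub>?F\<^esub> ?e x y)"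
      using a xy by (simp add: proj e)
  next
    fix x y y' assume xy: "x \<in> carrier M" "y \<in> carrier N" "y' \<in> carrier N"
    have "?e x (y \<oplus>\<^bsub>N\<^esub> y') \<ominus>\<^bsub>?F\<^esub> (?e x y \<oplus>\<^bsub>?F\<^esub> ?e x y') \<in> tensor_relators R M N"
      unfolding tensor_relators_def Let_def using xy by blast
    then have "?K +>\<^bsub>?F\<^esub> ?e x (y \<oplus>\<^bsub>N\<^esub> y') = ?K +>\<^bsub>?F\<^esub> (?e x y \<oplus>\<^bsub>?F\<^esub> ?e x y')"
      using xy by (intro coset_eq e F.M.a_closed) simp_all
    then show "?K +>\<^bsub>?F\<^esub> ?e x (y \<oplus>\<^bsub>N\<^esub> y')
      = (?K +>\<^bsub>?F\<^esub> ?e x y) \<oplus>\<^bsub>tensor R M N\<^esub> (?K +>\<^bsub>?F\<^esub> ?e x y')"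
      using xy by (simp add: proj e)
  next
    fix x x' y assume xy: "x \<in> carrier M" "x' \<in> carrier M" "y \<in> carrier N"
    have "?e (x \<oplus>\<^bsub>M\<^esub> x') y \<ominus>\<^bsub>?F\<^esub> (?e x y \<oplus>\<^bsub>?F\<^esub> ?e x' y) \<in> tensor_relators R M N"
      unfolding tensor_relators_def Let_def using xy by blast
    then have "?K +>\<^bsub>?F\<^esub> ?e (x \<oplus>\<^bsub>M\<^esub> x') y = ?K +>\<^bsub>?F\<^esub> (?e x y \<oplus>\<^bsub>?F\<^esub> ?e x' y)"
      using xy by (intro coset_eq e F.M.a_closed) simp_all
    then show "?K +>\<^bsub>?F\<^esub> ?e (x \<oplus>\<^bsub>M\<^esub> x') y
      = (?K +>\<^bsub>?F\<^esub> ?e x y) \<oplus>\<^bsub>tensor R M N\<^esub> (?K +>\<^bsub>?F\<^esub> ?e x' y)"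
      using xy by (simp add: proj e)
  qed (simp_all add: proj e)
qed

lemma tens_linear_left:
  assumes "module R M" and "module R N" and "y \<in> carrier N"
  shows "(\<lambda>x. tens R M N x y) \<in> linear_maps R M (tensor R M N)"
  using tens_bilinear[OF assms(1,2)] assms(3) by (rule bilinear_mapsD(2))

lemma tens_linear_right:
  assumes "module R M" and "module R N" and "x \<in> carrier M"
  shows "tens R M N x \<in> linear_maps R N (tensor R M N)"
  using tens_bilinear[OF assms(1,2)] assms(3) by (rule bilinear_mapsD(1))

lemma tens_closed:
  assumes "module R M" and "module R N" and "x \<in> carrier M" and "y \<in> carrier N"
  shows "tens R M N x y \<in> carrier (tensor R M N)"
  using linear_maps_closed[OF tens_linear_right[OF assms(1-3)] assms(4)] .

lemma tensor_induct [consumes 3, case_names tens add smult]: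
  assumes "module R M" and "module R N" and "t \<in> carrier (tensor R M N)"
    and tens: "\<And>x y. x \<in> carrier M \<Longrightarrow> y \<in> carrier N \<Longrightarrow> P (tens R M N x y)"
    and add: "\<And>t u. t \<in> carrier (tensor R M N) \<Longrightarrow> u \<in> carrier (tensor R M N)
      \<Longrightarrow> P t \<Longrightarrow> P u \<Longrightarrow> P (t \<oplus>\<^bsub>tensor R M N\<^esub> u)"
    and smult: "\<And>a t. a \<in> carrier R \<Longrightarrow> t \<in> carrier (tensor R M N) \<Longrightarrow> P t
      \<Longrightarrow> P (a \<odot>\<^bsub>tensor R M N\<^esub> t)"
  shows "P t"
proof -
  interpret M: module R M by fact
  interpret N: module R N by fact
  let ?F = "free_module R (carrier M \<times> carrier N)"
  let ?K = "tensor_kernel R M N"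
  have F: "module R ?F"
    by (rule free_module_module) (rule M.R.cring_axioms)
  interpret F: module R ?F
    by (rule F)
  have T: "module R (tensor R M N)"
    using assms(1,2) by (rule tensor_module)
  interpret T: module R "tensor R M N"
    by (rule T)
  have proj: "(\<lambda>\<phi>. ?K +>\<^bsub>?F\<^esub> \<phi>) \<in> linear_maps R ?F (tensor R M N)"
    unfolding tensor_def
    using F tensor_kernel_submodule[OF assms(1,2)] by (rule quotient_projection_linear)
  note p = linear_mapsD[OF proj]
  obtain \<phi> where \<phi>: "\<phi> \<in> carrier ?F" and t: "t = ?K +>\<^bsub>?F\<^esub> \<phi>"
    using assms(3) by (auto simp: tensor_def quotient_module_carrier)
  have "P (?K +>\<^bsub>?F\<^esub> \<phi>)"
    using M.R.cring_axioms \<phi>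
  proof (induction \<phi> rule: free_module_induct)
    case zero
    \<comment> \<open>Zero has no case of its own in this rule; it is obtained as the zero multiple
      of the pure tensor of two zeros.\<close>
    have t0: "tens R M N \<zero>\<^bsub>M\<^esub> \<zero>\<^bsub>N\<^esub> \<in> carrier (tensor R M N)"
      using assms(1,2) by (intro tens_closed) simp_all
    have "P (\<zero>\<^bsub>R\<^esub> \<odot>\<^bsub>tensor R M N\<^esub> tens R M N \<zero>\<^bsub>M\<^esub> \<zero>\<^bsub>N\<^esub>)"
      using t0 by (intro smult tens) simp_all
    then show ?case
      using t0 by (simp add: linear_maps_zero[OF proj F T])
  next
    case (basis s)
    then show ?case
      using tens[of "fst s" "snd s"] by (auto simp: tens_def)
  next
    case (add \<phi> \<psi>)
    then show ?case
      using assms(5) by (simp add: p)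
  next
    case (smult a \<phi>)
    then show ?case
      using assms(6) by (simp add: p)
  qed
  with t show ?thesis
    by simp
qed

text \<open>The linear extension of \<open>\<beta>\<close> to the free module kills every relator by
  bilinearity. Its kernel is a submodule, so it contains \<open>tensor_kernel\<close>, and the
  extension is constant on cosets.\<close>

lemma tensor_lift_linear:
  assumes "module R M" and "module R N" and "module R P" and "\<beta> \<in> bilinear_maps R M N P"
  shows "tensor_lift R P \<beta> \<in> linear_maps R (tensor R M N) P"
    and tensor_lift_tens:
      "x \<in> carrier M \<Longrightarrow> y \<in> carrier N \<Longrightarrow> tensor_lift R P \<beta> (tens R M N x y) = \<beta> x y"
proof -
  interpret M: module R M by fact
  interpret N: module R N by fact
  interpret P: module R P by fact
  let ?F = "free_module R (carrier M \<times> carrier N)"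
  let ?K = "tensor_kernel R M N"
  let ?b = "\<lambda>s. \<beta> (fst s) (snd s)"
  let ?L = "free_lift R P ?b"
  have F: "module R ?F"
    by (rule free_module_module) (rule M.R.cring_axioms)
  interpret F: module R ?F
    by (rule F)
  have K: "submodule ?K R ?F"
    using assms(1,2) by (rule tensor_kernel_submodule)
  have T: "module R (tensor R M N)"
    using assms(1,2) by (rule tensor_module)
  have proj: "(\<lambda>\<phi>. ?K +>\<^bsub>?F\<^esub> \<phi>) \<in> linear_maps R ?F (tensor R M N)"
    unfolding tensor_def using F K by (rule quotient_projection_linear)
  note p = linear_mapsD[OF proj]
  note right = linear_mapsD[OF bilinear_mapsD(1)[OF assms(4)]]
  note left = linear_mapsD[OF bilinear_mapsD(2)[OF assms(4)]]
  have b: "?b \<in> carrier M \<times> carrier N \<rightarrow> carrier P"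
    using right(1) by auto
  have L: "?L \<in> linear_maps R ?F P"
    using assms(3) b by (rule free_lift_linear)
  note l = linear_mapsD[OF L]
  have e: "free_basis R (x, y) \<in> carrier ?F" if "x \<in> carrier M" "y \<in> carrier N" for x y
    using that by (intro free_basis_closed M.R.cring_axioms) simp
  have Le: "?L (free_basis R (x, y)) = \<beta> x y" if "x \<in> carrier M" "y \<in> carrier N" for x y
    using that free_lift_basis[OF assms(3) b, of "(x, y)"] by simp
  have "?K \<subseteq> {\<phi> \<in> carrier ?F. ?L \<phi> = \<zero>\<^bsub>P\<^esub>}"
    unfolding tensor_kernel_def
  proof (rule hull_minimal)
    show "submodule {\<phi> \<in> carrier ?F. ?L \<phi> = \<zero>\<^bsub>P\<^esub>} R ?F"
      using L F assms(3) by (rule kernel_submodule)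
    have minus_self: "u \<ominus>\<^bsub>P\<^esub> u = \<zero>\<^bsub>P\<^esub>" if "u \<in> carrier P" for u
      using that by (simp add: a_minus_def P.M.r_neg)
    have "?L \<phi> = \<zero>\<^bsub>P\<^esub>" if "\<phi> \<in> tensor_relators R M N" for \<phi>
      using that by (auto simp: tensor_relators_def Let_def e Le l left right
          linear_maps_minus[OF L F assms(3)] minus_self)
    with tensor_relators_closed[OF assms(1,2)]
    show "tensor_relators R M N \<subseteq> {\<phi> \<in> carrier ?F. ?L \<phi> = \<zero>\<^bsub>P\<^esub>}"
      by blast
  qed
  then have lift: "tensor_lift R P \<beta> (?K +>\<^bsub>?F\<^esub> \<phi>) = ?L \<phi>" if "\<phi> \<in> carrier ?F" for \<phi>
    using quotient_lift[OF F K assms(3) L _ that]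
    by (auto simp: tensor_lift_def free_lift_def[abs_def])
  have carrierE: "\<exists>\<phi>\<in>carrier ?F. t = ?K +>\<^bsub>?F\<^esub> \<phi>" if "t \<in> carrier (tensor R M N)" for t
    using that by (auto simp: tensor_def quotient_module_carrier)
  show "tensor_lift R P \<beta> \<in> linear_maps R (tensor R M N) P"
    by (rule linear_mapsI) (auto dest!: carrierE simp: lift l p(2,3)[symmetric])
  show "tensor_lift R P \<beta> (tens R M N x y) = \<beta> x y" if "x \<in> carrier M" "y \<in> carrier N"
    using that by (simp add: tens_def lift e Le)
qed

text \<open>The uniqueness half of the universal property. Identities between composites of tensor
  maps are reduced by it to a computation on pure tensors.\<close>

lemma tensor_linear_eq:
  assumes "module R M" and "module R N"
    and f: "f \<in> linear_maps R (tensor R M N) P" and g: "g \<in> linear_maps R (tensor R M N) P"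
    and eq: "\<And>x y. x \<in> carrier M \<Longrightarrow> y \<in> carrier N \<Longrightarrow> f (tens R M N x y) = g (tens R M N x y)"
    and "t \<in> carrier (tensor R M N)"
  shows "f t = g t"
  using assms(1,2,6)
  by (induction t rule: tensor_induct) (simp_all add: eq linear_mapsD[OF f] linear_mapsD[OF g])

text \<open>The tensors \<open>t\<close> at which \<open>\<Phi> k t\<close> is linear in
  \<open>k\<close> are closed under sums and, since the ring is commutative, under scalar multiples;
  so pure tensors decide. It is needed wherever a lift depends on a parameter: for iterated lifts
  and for the map sending \<open>f\<close>, \<open>g\<close> to their tensor product.\<close>

lemma tensor_pointwise_linear:
  assumes "module R K" and "module R M" and "module R N" and "module R P"
    and lin: "\<And>k. k \<in> carrier K \<Longrightarrow> \<Phi> k \<in> linear_maps R (tensor R M N) P"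
    and pure: "\<And>x y. x \<in> carrier M \<Longrightarrow> y \<in> carrier N
      \<Longrightarrow> (\<lambda>k. \<Phi> k (tens R M N x y)) \<in> linear_maps R K P"
    and "t \<in> carrier (tensor R M N)"
  shows "(\<lambda>k. \<Phi> k t) \<in> linear_maps R K P"
proof -
  interpret K: module R K by fact
  interpret P: module R P by fact
  note l = linear_mapsD[OF lin]
  show ?thesis
    using assms(2,3,7)
  proof (induction t rule: tensor_induct)
    case (tens x y)
    then show ?case
      by (rule pure)
  next
    case (add t u)
    note t = linear_mapsD[OF add.IH(1)] and u = linear_mapsD[OF add.IH(2)]
    show ?case
      by (rule linear_mapsI)
        (simp_all add: l add.hyps t u P.smult_r_distr P.M.a_ac)
  next
    case (smult a t)
    note t = linear_mapsD[OF smult.IH]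
    show ?case
      by (rule linear_mapsI)
        (simp_all add: l smult.hyps t P.smult_r_distr K.m_comm flip: P.smult_assoc1)
  qed
qed

section \<open>Tensor products of linear maps\<close>

lemma tensor_map_bilinear:
  assumes "module R K" and "module R L" and "module R M" and "module R N"
    and "f \<in> linear_maps R K M" and "g \<in> linear_maps R L N"
  shows "(\<lambda>x y. tens R M N (f x) (g y)) \<in> bilinear_maps R K L (tensor R M N)"
proof (rule bilinear_mapsI)
  show "(\<lambda>y. tens R M N (f x) (g y)) \<in> linear_maps R L (tensor R M N)" if "x \<in> carrier K" for x
    using assms(6) tens_linear_right[OF assms(3,4) linear_maps_closed[OF assms(5) that]]
    by (rule linear_maps_comp)
  show "(\<lambda>x. tens R M N (f x) (g y)) \<in> linear_maps R K (tensor R M N)" if "y \<in> carrier L" for y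
    using assms(5) tens_linear_left[OF assms(3,4) linear_maps_closed[OF assms(6) that]]
    by (rule linear_maps_comp)
qed

lemma tensor_map_linear:
  assumes "module R K" and "module R L" and "module R M" and "module R N"
    and "f \<in> linear_maps R K M" and "g \<in> linear_maps R L N"
  shows "tensor_map R M N f g \<in> linear_maps R (tensor R K L) (tensor R M N)"
    and tensor_map_tens: "x \<in> carrier K \<Longrightarrow> y \<in> carrier L
      \<Longrightarrow> tensor_map R M N f g (tens R K L x y) = tens R M N (f x) (g y)"
proof -
  note lift = tensor_lift_linear[OF assms(1,2) tensor_module[OF assms(3,4)] tensor_map_bilinear[OF assms]]
  show "tensor_map R M N f g \<in> linear_maps R (tensor R K L) (tensor R M N)"
    unfolding tensor_map_def by (rule lift(1))
  show "tensor_map R M N f g (tens R K L x y) = tens R M N (f x) (g y)"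
    if "x \<in> carrier K" "y \<in> carrier L"
    unfolding tensor_map_def using that by (rule lift(2))
qed

section \<open>The third tensor power\<close>

lemma tensor_cube_module: "module R N \<Longrightarrow> module R (tensor_cube R N)"
  by (simp add: tensor_cube_def tensor_module)

text \<open>Uniqueness is applied twice: first to the outer product, then, with the first factor
  fixed, to the inner one.\<close>

lemma tensor_cube_linear_eq:
  assumes "module R N"
    and f: "f \<in> linear_maps R (tensor_cube R N) P" and g: "g \<in> linear_maps R (tensor_cube R N) P"
    and eq: "\<And>x y z. x \<in> carrier N \<Longrightarrow> y \<in> carrier N \<Longrightarrow> z \<in> carrier N
      \<Longrightarrow> f (tens3 R N x y z) = g (tens3 R N x y z)"
    and "t \<in> carrier (tensor_cube R N)"
  shows "f t = g t"
  using assms(1) tensor_module[OF assms(1,1)]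
proof (rule tensor_linear_eq)
  fix x u assume x: "x \<in> carrier N" and u: "u \<in> carrier (tensor R N N)"
  note lin = tens_linear_right[OF assms(1) tensor_module[OF assms(1,1)] x]
  show "f (tens R N (tensor R N N) x u) = g (tens R N (tensor R N N) x u)"
    using assms(1,1) linear_maps_comp[OF lin f[unfolded tensor_cube_def]]
      linear_maps_comp[OF lin g[unfolded tensor_cube_def]]
    by (rule tensor_linear_eq) (use x u eq in \<open>simp_all add: tens3_def\<close>)
qed (use assms in \<open>simp_all add: tensor_cube_def\<close>)

lemma tens3_trilinear:
  assumes "module R N"
  shows "tens3 R N \<in> trilinear_maps R N (tensor_cube R N)"
proof (rule trilinear_mapsI)
  have T: "module R (tensor R N N)"
    using assms by (simp add: tensor_module)
  fix y z assume y: "y \<in> carrier N" and z: "z \<in> carrier N"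
  show "(\<lambda>x. tens3 R N x y z) \<in> linear_maps R N (tensor_cube R N)"
    unfolding tens3_def tensor_cube_def
    using assms T tens_closed[OF assms assms y z] by (rule tens_linear_left)
  show "(\<lambda>x. tens3 R N y x z) \<in> linear_maps R N (tensor_cube R N)"
    unfolding tens3_def tensor_cube_def
    using tens_linear_left[OF assms assms z] tens_linear_right[OF assms T y]
    by (rule linear_maps_comp)
  show "tens3 R N y z \<in> linear_maps R N (tensor_cube R N)"
    unfolding tens3_def[abs_def] tensor_cube_def
    using tens_linear_right[OF assms assms z] tens_linear_right[OF assms T y]
    by (rule linear_maps_comp)
qed

lemma tens3_closed:
  assumes "module R N" and "x \<in> carrier N" and "y \<in> carrier N" and "z \<in> carrier N"
  shows "tens3 R N x y z \<in> carrier (tensor_cube R N)"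
  using assms by (simp add: tens3_def tensor_cube_def tens_closed tensor_module)

text \<open>The universal property is iterated. The delicate point is that the inner lift, taken at
  an arbitrary tensor \<open>u\<close>, is still linear in the first argument;
  \<open>tensor_pointwise_linear\<close> reduces this to pure \<open>u\<close>.\<close>

lemma tensor_cube_lift_linear:
  assumes "module R N" and "module R P" and "\<gamma> \<in> trilinear_maps R N P"
  shows "tensor_cube_lift R P \<gamma> \<in> linear_maps R (tensor_cube R N) P"
    and tensor_cube_lift_tens3: "x \<in> carrier N \<Longrightarrow> y \<in> carrier N \<Longrightarrow> z \<in> carrier N
      \<Longrightarrow> tensor_cube_lift R P \<gamma> (tens3 R N x y z) = \<gamma> x y z"
proof -
  have T: "module R (tensor R N N)"
    using assms(1) by (simp add: tensor_module)
  note tri = trilinear_mapsD[OF assms(3)]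
  note lift = tensor_lift_linear(1)[OF assms(1,1,2) tri(1)]
    and lift_tens = tensor_lift_tens[OF assms(1,1,2) tri(1)]
  have bil: "(\<lambda>x. tensor_lift R P (\<gamma> x)) \<in> bilinear_maps R N (tensor R N N) P"
  proof (rule bilinear_mapsI)
    fix u assume u: "u \<in> carrier (tensor R N N)"
    show "(\<lambda>x. tensor_lift R P (\<gamma> x) u) \<in> linear_maps R N P"
      using assms(1,1,1,2) lift
    proof (rule tensor_pointwise_linear)
      fix y z assume yz: "y \<in> carrier N" "z \<in> carrier N"
      show "(\<lambda>x. tensor_lift R P (\<gamma> x) (tens R N N y z)) \<in> linear_maps R N P"
        by (rule linear_maps_cong[OF tri(2)[OF yz] assms(1)]) (simp add: lift_tens yz)
    qed (simp_all add: u)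
  qed (rule lift)
  note lin = tensor_lift_linear[OF assms(1) T assms(2) bil]
  show "tensor_cube_lift R P \<gamma> \<in> linear_maps R (tensor_cube R N) P"
    using lin(1) by (simp add: tensor_cube_lift_def tensor_cube_def)
  show "tensor_cube_lift R P \<gamma> (tens3 R N x y z) = \<gamma> x y z"
    if "x \<in> carrier N" "y \<in> carrier N" "z \<in> carrier N"
    using that by (simp add: tensor_cube_lift_def tens3_def lin(2) tens_closed assms(1) lift_tens)
qed

text \<open>The tensor product of three maps that occurs in the overview, bracketed to the right
  like \<open>tensor_cube\<close>.\<close>

definition tensor_cube_map ::
  "('r, 'p) ring_scheme \<Rightarrow> ('r, 'n, 's) module_scheme \<Rightarrow> ('m \<Rightarrow> 'n) \<Rightarrow> ('m \<Rightarrow> 'n) \<Rightarrow> ('m \<Rightarrow> 'n)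
    \<Rightarrow> ('m \<times> ('m \<times> 'm \<Rightarrow> 'r) set \<Rightarrow> 'r) set \<Rightarrow> ('n \<times> ('n \<times> 'n \<Rightarrow> 'r) set \<Rightarrow> 'r) set"
  where "tensor_cube_map R N f g h = tensor_map R N (tensor R N N) f (tensor_map R N N g h)"

lemma tensor_cube_map_linear:
  assumes "module R M" and "module R N"
    and "f \<in> linear_maps R M N" and "g \<in> linear_maps R M N" and "h \<in> linear_maps R M N"
  shows "tensor_cube_map R N f g h \<in> linear_maps R (tensor_cube R M) (tensor_cube R N)"
    and tensor_cube_map_tens3: "x \<in> carrier M \<Longrightarrow> y \<in> carrier M \<Longrightarrow> z \<in> carrier M
      \<Longrightarrow> tensor_cube_map R N f g h (tens3 R M x y z) = tens3 R N (f x) (g y) (h z)"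
proof -
  note gh = tensor_map_linear[OF assms(1,1,2,2,4,5)]
  note TM = tensor_module[OF assms(1,1)] and TN = tensor_module[OF assms(2,2)]
  note fgh = tensor_map_linear[OF assms(1) TM assms(2) TN assms(3) gh(1)]
  show "tensor_cube_map R N f g h \<in> linear_maps R (tensor_cube R M) (tensor_cube R N)"
    using fgh(1) by (simp add: tensor_cube_map_def tensor_cube_def)
  show "tensor_cube_map R N f g h (tens3 R M x y z) = tens3 R N (f x) (g y) (h z)"
    if "x \<in> carrier M" "y \<in> carrier M" "z \<in> carrier M"
    using that by (simp add: tensor_cube_map_def tens3_def fgh(2) gh(2) tens_closed assms(1))
qed

lemma tensor_assoc_linear:
  assumes "module R N"
  shows "tensor_assoc R N \<in> linear_maps R (tensor_cube R N) (tensor R (tensor R N N) N)"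
    and tensor_assoc_tens3: "x \<in> carrier N \<Longrightarrow> y \<in> carrier N \<Longrightarrow> z \<in> carrier N
      \<Longrightarrow> tensor_assoc R N (tens3 R N x y z) = tens R (tensor R N N) N (tens R N N x y) z"
proof -
  note T = tensor_module[OF assms assms]
  have "(\<lambda>x y z. tens R (tensor R N N) N (tens R N N x y) z)
      \<in> trilinear_maps R N (tensor R (tensor R N N) N)"
  proof (rule trilinear_mapsI)
    fix y z assume y: "y \<in> carrier N" and z: "z \<in> carrier N"
    show "(\<lambda>x. tens R (tensor R N N) N (tens R N N x y) z)
        \<in> linear_maps R N (tensor R (tensor R N N) N)"
      using tens_linear_left[OF assms assms y] tens_linear_left[OF T assms z]
      by (rule linear_maps_comp)
    show "(\<lambda>x. tens R (tensor R N N) N (tens R N N y x) z)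
        \<in> linear_maps R N (tensor R (tensor R N N) N)"
      using tens_linear_right[OF assms assms y] tens_linear_left[OF T assms z]
      by (rule linear_maps_comp)
    show "tens R (tensor R N N) N (tens R N N y z) \<in> linear_maps R N (tensor R (tensor R N N) N)"
      using T assms tens_closed[OF assms assms y z] by (rule tens_linear_right)
  qed
  note lift = tensor_cube_lift_linear[OF assms tensor_module[OF T assms] this]
  show "tensor_assoc R N \<in> linear_maps R (tensor_cube R N) (tensor R (tensor R N N) N)"
    unfolding tensor_assoc_def by (rule lift(1))
  show "tensor_assoc R N (tens3 R N x y z) = tens R (tensor R N N) N (tens R N N x y) z"
    if "x \<in> carrier N" "y \<in> carrier N" "z \<in> carrier N"
    unfolding tensor_assoc_def using that by (rule lift(2))
qed

lemma associator_linear: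
  assumes "module R N" and "\<mu> \<in> linear_maps R (tensor R N N) N"
  shows "associator R N \<mu> \<in> linear_maps R (tensor_cube R N) N"
    and associator_tens3: "x \<in> carrier N \<Longrightarrow> y \<in> carrier N \<Longrightarrow> z \<in> carrier N
      \<Longrightarrow> associator R N \<mu> (tens3 R N x y z)
        = \<mu> (tens R N N (\<mu> (tens R N N x y)) z) \<ominus>\<^bsub>N\<^esub> \<mu> (tens R N N x (\<mu> (tens R N N y z)))"
proof -
  note T = tensor_module[OF assms(1,1)]
  note left = tensor_map_linear[OF T assms(1,1,1,2) linear_maps_id]
    and right = tensor_map_linear[OF assms(1) T assms(1,1) linear_maps_id assms(2)]
    and assoc = tensor_assoc_linear[OF assms(1)]
  show "associator R N \<mu> \<in> linear_maps R (tensor_cube R N) N"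
    unfolding associator_def[abs_def]
  proof (rule linear_maps_diff)
    show "(\<lambda>t. \<mu> (tensor_map R N N \<mu> id (tensor_assoc R N t))) \<in> linear_maps R (tensor_cube R N) N"
      using linear_maps_comp[OF assoc(1) left(1)] assms(2) by (rule linear_maps_comp)
    show "(\<lambda>t. \<mu> (tensor_map R N N id \<mu> t)) \<in> linear_maps R (tensor_cube R N) N"
      unfolding tensor_cube_def using right(1) assms(2) by (rule linear_maps_comp)
  qed (rule assms(1))
  show "associator R N \<mu> (tens3 R N x y z)
      = \<mu> (tens R N N (\<mu> (tens R N N x y)) z) \<ominus>\<^bsub>N\<^esub> \<mu> (tens R N N x (\<mu> (tens R N N y z)))"
    if "x \<in> carrier N" "y \<in> carrier N" "z \<in> carrier N"
  proof -
    have "tensor_map R N N id \<mu> (tens3 R N x y z) = tens R N N x (\<mu> (tens R N N y z))"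
      using that by (simp add: tens3_def right(2) tens_closed assms(1))
    with that show ?thesis
      by (simp add: associator_def assoc(2) left(2) tens_closed assms(1))
  qed
qed

section \<open>Permutations of tensors\<close>

text \<open>\<open>perm_map\<close> depends on \<open>\<sigma>\<close> only through these three
  values of its inverse. They are distinct members of \<open>{1, 2, 3}\<close>, which leaves six
  possibilities.\<close>

lemma inv_permutes_three_cases:
  fixes \<sigma> :: "nat \<Rightarrow> nat"
  assumes "\<sigma> permutes {1, 2, 3}"
  obtains "inv_into UNIV \<sigma> 1 = 1" "inv_into UNIV \<sigma> 2 = 2" "inv_into UNIV \<sigma> 3 = 3"
  | "inv_into UNIV \<sigma> 1 = 1" "inv_into UNIV \<sigma> 2 = 3" "inv_into UNIV \<sigma> 3 = 2"
  | "inv_into UNIV \<sigma> 1 = 2" "inv_into UNIV \<sigma> 2 = 1" "inv_into UNIV \<sigma> 3 = 3"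
  | "inv_into UNIV \<sigma> 1 = 2" "inv_into UNIV \<sigma> 2 = 3" "inv_into UNIV \<sigma> 3 = 1"
  | "inv_into UNIV \<sigma> 1 = 3" "inv_into UNIV \<sigma> 2 = 1" "inv_into UNIV \<sigma> 3 = 2"
  | "inv_into UNIV \<sigma> 1 = 3" "inv_into UNIV \<sigma> 2 = 2" "inv_into UNIV \<sigma> 3 = 1"
proof -
  have inv: "inv_into UNIV \<sigma> permutes {1, 2, 3}"
    using assms by (rule permutes_inv)
  have "inv_into UNIV \<sigma> k \<in> {1, 2, 3}" if "k \<in> {1, 2, 3}" for k
    using permutes_in_image[OF inv] that by blast
  then have range: "inv_into UNIV \<sigma> 1 \<in> {1, 2, 3}" "inv_into UNIV \<sigma> 2 \<in> {1, 2, 3}" "inv_into UNIV \<sigma> 3 \<in> {1, 2, 3}"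
    by simp_all
  have "inj (inv_into UNIV \<sigma>)"
    using inv by (rule permutes_inj)
  then have "inv_into UNIV \<sigma> 1 \<noteq> inv_into UNIV \<sigma> 2" "inv_into UNIV \<sigma> 1 \<noteq> inv_into UNIV \<sigma> 3" "inv_into UNIV \<sigma> 2 \<noteq> inv_into UNIV \<sigma> 3"
    by (simp_all add: inj_eq)
  with range that show thesis
    unfolding insert_iff empty_iff by metis
qed

text \<open>The slot an argument occupies depends on \<open>\<sigma>\<close>, so trilinearity is
  checked in each of the six cases. The factors form an indexed family \<open>x\<close>, which
  allows one formula for all \<open>\<sigma>\<close>.\<close>

lemma perm_map_linear:
  assumes "module R N" and "\<sigma> permutes {1, 2, 3}"
  shows "perm_map R N \<sigma> \<in> linear_maps R (tensor_cube R N) (tensor_cube R N)"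
    and perm_map_tens3: "(\<And>k. k \<in> {1, 2, 3} \<Longrightarrow> x k \<in> carrier N)
      \<Longrightarrow> perm_map R N \<sigma> (tens3 R N (x 1) (x 2) (x 3)) = tens3 R N (x (inv_into UNIV \<sigma> 1)) (x (inv_into UNIV \<sigma> 2)) (x (inv_into UNIV \<sigma> 3))"
proof -
  let ?\<gamma> = "\<lambda>x1 x2 x3. let x = (\<lambda>k. [x1, x2, x3] ! (k - 1)); \<tau> = inv_into UNIV \<sigma>
        in tens3 R N (x (\<tau> 1)) (x (\<tau> 2)) (x (\<tau> 3))"
  note tri = trilinear_mapsD[OF tens3_trilinear[OF assms(1)]]
  note lin = tri(2) bilinear_mapsD[OF tri(1)]
  have "?\<gamma> \<in> trilinear_maps R N (tensor_cube R N)"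
    using assms(2)
    by (cases rule: inv_permutes_three_cases)
      (rule trilinear_mapsI; simp add: lin numeral_2_eq_2 numeral_3_eq_3)+
  note lift = tensor_cube_lift_linear[OF assms(1) tensor_cube_module[OF assms(1)] this]
  show "perm_map R N \<sigma> \<in> linear_maps R (tensor_cube R N) (tensor_cube R N)"
    unfolding perm_map_def by (rule lift(1))
  show "perm_map R N \<sigma> (tens3 R N (x 1) (x 2) (x 3)) = tens3 R N (x (inv_into UNIV \<sigma> 1)) (x (inv_into UNIV \<sigma> 2)) (x (inv_into UNIV \<sigma> 3))"
    if x: "\<And>k. k \<in> {1, 2, 3} \<Longrightarrow> x k \<in> carrier N"
  proof -
    have "perm_map R N \<sigma> (tens3 R N (x 1) (x 2) (x 3)) = ?\<gamma> (x 1) (x 2) (x 3)"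
      unfolding perm_map_def using x by (intro lift(2)) simp_all
    also have "\<dots> = tens3 R N (x (inv_into UNIV \<sigma> 1)) (x (inv_into UNIV \<sigma> 2)) (x (inv_into UNIV \<sigma> 3))"
      using assms(2) by (cases rule: inv_permutes_three_cases) simp_all
    finally show ?thesis .
  qed
qed

text \<open>Naturality of permutations: with \<open>\<tau>\<close> the inverse of
  \<open>\<sigma>\<close>, on a pure tensor both sides have
  \<open>f (\<tau> k) (x (\<tau> k))\<close> in place \<open>k\<close>.\<close>

lemma perm_map_tensor_cube_map:
  fixes f :: "nat \<Rightarrow> 'm \<Rightarrow> 'n"
  assumes "module R M" and "module R N" and "\<sigma> permutes {1, 2, 3}"
    and f: "\<And>k. k \<in> {1, 2, 3} \<Longrightarrow> f k \<in> linear_maps R M N"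
    and "t \<in> carrier (tensor_cube R M)"
  shows "tensor_cube_map R N (f (inv_into UNIV \<sigma> 1)) (f (inv_into UNIV \<sigma> 2)) (f (inv_into UNIV \<sigma> 3)) (perm_map R M \<sigma> t)
    = perm_map R N \<sigma> (tensor_cube_map R N (f 1) (f 2) (f 3) t)"
proof -
  note permM = perm_map_linear[OF assms(1,3)] and permN = perm_map_linear[OF assms(2,3)]
  have inv: "inv_into UNIV \<sigma> k \<in> {1, 2, 3}" if "k \<in> {1, 2, 3}" for k
    using permutes_in_image[OF permutes_inv[OF assms(3)]] that by blast
  have f\<sigma>: "f (inv_into UNIV \<sigma> k) \<in> linear_maps R M N" if "k \<in> {1, 2, 3}" for k
    using f[OF inv[OF that]] .
  have f123: "f 1 \<in> linear_maps R M N" "f 2 \<in> linear_maps R M N" "f 3 \<in> linear_maps R M N"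
    using f by simp_all
  have f\<sigma>123: "f (inv_into UNIV \<sigma> 1) \<in> linear_maps R M N" "f (inv_into UNIV \<sigma> 2) \<in> linear_maps R M N"
    "f (inv_into UNIV \<sigma> 3) \<in> linear_maps R M N"
    using f\<sigma> by simp_all
  note cube = tensor_cube_map_linear[OF assms(1,2) f123]
    and cube\<sigma> = tensor_cube_map_linear[OF assms(1,2) f\<sigma>123]
  show ?thesis
    using assms(1) linear_maps_comp[OF permM(1) cube\<sigma>(1)] linear_maps_comp[OF cube(1) permN(1)]
  proof (rule tensor_cube_linear_eq)
    fix x1 x2 x3 assume x123: "x1 \<in> carrier M" "x2 \<in> carrier M" "x3 \<in> carrier M"
    \<comment> \<open>The last branch also covers indices outside \<open>{1, 2, 3}\<close>, so that
      \<open>x k\<close> is in the carrier for every \<open>k\<close>.\<close>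
    define x where "x = (\<lambda>k::nat. if k = 1 then x1 else if k = 2 then x2 else x3)"
    have x: "x k \<in> carrier M" for k
      using x123 by (simp add: x_def)
    have fx: "f k (x k) \<in> carrier N" if "k \<in> {1, 2, 3}" for k
      using linear_maps_closed[OF f[OF that] x] .
    have "tensor_cube_map R N (f (inv_into UNIV \<sigma> 1)) (f (inv_into UNIV \<sigma> 2)) (f (inv_into UNIV \<sigma> 3))
        (perm_map R M \<sigma> (tens3 R M (x 1) (x 2) (x 3)))
      = perm_map R N \<sigma> (tensor_cube_map R N (f 1) (f 2) (f 3) (tens3 R M (x 1) (x 2) (x 3)))"
      \<comment> \<open>On the right the permutation acts after the maps, hence on the family of
        images \<open>f k (x k)\<close>.\<close>
      using permN(2)[of "\<lambda>k. f k (x k)"] fx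
      by (simp only: permM(2)[of x] x cube\<sigma>(2) cube(2))
    then show "tensor_cube_map R N (f (inv_into UNIV \<sigma> 1)) (f (inv_into UNIV \<sigma> 2)) (f (inv_into UNIV \<sigma> 3))
        (perm_map R M \<sigma> (tens3 R M x1 x2 x3))
      = perm_map R N \<sigma> (tensor_cube_map R N (f 1) (f 2) (f 3) (tens3 R M x1 x2 x3))"
      by (simp add: x_def)
  qed (rule assms(5))
qed

section \<open>Signed sums of permutations\<close>

lemma alternating_sum_linear:
  assumes "module R N" and "finite G" and "\<And>\<sigma>. \<sigma> \<in> G \<Longrightarrow> \<sigma> permutes {1, 2, 3}"
  shows "alternating_sum R N G \<in> linear_maps R (tensor_cube R N) (tensor_cube R N)"
  unfolding alternating_sum_def[abs_def]
  using assms(1) tensor_cube_module[OF assms(1)]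
  by (intro linear_maps_sum assms(2) linear_maps_scaled_int perm_map_linear assms(3))

text \<open>Linear maps respect finite sums and integer multiples. The main proof uses this once to
  open the signed sum over \<open>Hom(C,A)\<close> and once, reversed, to close the one over
  \<open>A\<close>.\<close>

lemma linear_maps_alternating_sum:
  assumes "module R N" and "finite G" and "\<And>\<sigma>. \<sigma> \<in> G \<Longrightarrow> \<sigma> permutes {1, 2, 3}"
    and "module R P" and f: "f \<in> linear_maps R (tensor_cube R N) P"
    and t: "t \<in> carrier (tensor_cube R N)"
  shows "f (alternating_sum R N G t) = (\<Oplus>\<^bsub>P\<^esub>\<sigma>\<in>G. [sign \<sigma>] \<cdot>\<^bsub>P\<^esub> f (perm_map R N \<sigma> t))"
proof -
  note T = tensor_cube_module[OF assms(1)]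
  interpret T: module R "tensor_cube R N"
    by (rule T)
  interpret P: module R P
    by fact
  have perm: "perm_map R N \<sigma> t \<in> carrier (tensor_cube R N)" if "\<sigma> \<in> G" for \<sigma>
    using perm_map_linear(1)[OF assms(1) assms(3)[OF that]] t by (rule linear_maps_closed)
  have "f (alternating_sum R N G t)
    = (\<Oplus>\<^bsub>P\<^esub>\<sigma>\<in>G. f ([sign \<sigma>] \<cdot>\<^bsub>tensor_cube R N\<^esub> perm_map R N \<sigma> t))"
    unfolding alternating_sum_def
    using f T assms(4,2) by (rule linear_maps_finsum) (simp add: perm)
  also have "\<dots> = (\<Oplus>\<^bsub>P\<^esub>\<sigma>\<in>G. [sign \<sigma>] \<cdot>\<^bsub>P\<^esub> f (perm_map R N \<sigma> t))"
    by (intro P.M.finsum_cong')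
      (simp_all add: perm linear_maps_int_pow[OF f T assms(4)] linear_maps_closed[OF f])
  finally show ?thesis .
qed

text \<open>The six choices of \<open>i\<close> are treated uniformly: each yields a finite set of
  permutations of \<open>{1, 2, 3}\<close>.\<close>

lemma Sigma3_subgroup_permutes: "\<sigma> \<in> Sigma3_subgroup i \<Longrightarrow> \<sigma> permutes {1, 2, 3}"
  using cycle_permutes[of "[1, 2, 3::nat]"] cycle_permutes[of "[1, 3, 2::nat]"]
  by (auto simp: Sigma3_subgroup_def insert_commute permutes_id permutes_swap_id split: if_splits)

lemma finite_Sigma3_subgroup: "finite (Sigma3_subgroup i)"
  by (rule finite_subset[OF _ finite_permutations[of "{1, 2, 3}"]])
    (auto dest: Sigma3_subgroup_permutes)

section \<open>The convolution algebra\<close>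

text \<open>The work is bilinearity of the tensor product of maps in its two factors. At a pure
  tensor, with one factor fixed, it is evaluation of the other followed by tensoring with a fixed
  element; \<open>tensor_pointwise_linear\<close> extends this to all tensors.\<close>

lemma lambda2_linear:
  assumes "module R C" and "module R A"
  defines "H \<equiv> Hom_module R C A"
  shows "lambda2 R C A \<in> linear_maps R (tensor R H H) (Hom_module R (tensor R C C) (tensor R A A))"
    and lambda2_tens: "f \<in> carrier H \<Longrightarrow> g \<in> carrier H
      \<Longrightarrow> lambda2 R C A (tens R H H f g) = restrict (tensor_map R A A f g) (carrier (tensor R C C))"
proof -
  note CC = tensor_module[OF assms(1,1)] and AA = tensor_module[OF assms(2,2)]
  have H: "module R H"
    unfolding H_def using assms(1,2) by (rule Hom_module_module)
  have lin: "f \<in> linear_maps R C A" if "f \<in> carrier H" for f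
    using that by (simp add: H_def Hom_module_linear)
  have eval: "(\<lambda>f. f x) \<in> linear_maps R H A" if "x \<in> carrier C" for x
    unfolding H_def using that by (rule Hom_module_eval)
  note map = tensor_map_linear[OF assms(1,1,2,2) lin lin]
  have "(\<lambda>f g. restrict (tensor_map R A A f g) (carrier (tensor R C C)))
      \<in> bilinear_maps R H H (Hom_module R (tensor R C C) (tensor R A A))"
  proof (intro bilinear_mapsI linear_maps_into_Hom_moduleI Hom_module_carrierI H CC map(1))
    \<comment> \<open>\<open>f\<close> is the fixed factor in both halves: on the left in the first,
      on the right in the second.\<close>
    fix f t assume f: "f \<in> carrier H" and t: "t \<in> carrier (tensor R C C)"
    show "(\<lambda>g. tensor_map R A A f g t) \<in> linear_maps R H (tensor R A A)"
      using H assms(1,1) AA map(1)[OF f]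
    proof (rule tensor_pointwise_linear)
      fix x y assume x: "x \<in> carrier C" and y: "y \<in> carrier C"
      have "f x \<in> carrier A"
        using lin[OF f] x by (rule linear_maps_closed)
      from linear_maps_comp[OF eval[OF y] tens_linear_right[OF assms(2,2) this]]
      show "(\<lambda>g. tensor_map R A A f g (tens R C C x y)) \<in> linear_maps R H (tensor R A A)"
        using H by (rule linear_maps_cong) (simp add: map(2) f x y)
    qed (simp_all add: t)
    show "(\<lambda>g. tensor_map R A A g f t) \<in> linear_maps R H (tensor R A A)"
      using H assms(1,1) AA map(1)[OF _ f]
    proof (rule tensor_pointwise_linear)
      fix x y assume x: "x \<in> carrier C" and y: "y \<in> carrier C"
      have "f y \<in> carrier A"
        using lin[OF f] y by (rule linear_maps_closed)
      from linear_maps_comp[OF eval[OF x] tens_linear_left[OF assms(2,2) this]]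
      show "(\<lambda>g. tensor_map R A A g f (tens R C C x y)) \<in> linear_maps R H (tensor R A A)"
        using H by (rule linear_maps_cong) (simp add: map(2) f x y)
    qed (simp_all add: t)
  qed
  note lift = tensor_lift_linear[OF H H Hom_module_module[OF CC AA] this]
  show "lambda2 R C A \<in> linear_maps R (tensor R H H) (Hom_module R (tensor R C C) (tensor R A A))"
    unfolding lambda2_def by (rule lift(1))
  show "lambda2 R C A (tens R H H f g) = restrict (tensor_map R A A f g) (carrier (tensor R C C))"
    if "f \<in> carrier H" "g \<in> carrier H"
    unfolding lambda2_def using that by (rule lift(2))
qed

section \<open>The two bracketings of a triple convolution product and their difference\<close>

locale convolution_data = C: module R C + A: module R A
  for R (structure) and C (structure) and A (structure)
    and \<mu> :: "('a \<times> 'a \<Rightarrow> 'r) set \<Rightarrow> 'a" and \<Delta> :: "'c \<Rightarrow> ('c \<times> 'c \<Rightarrow> 'r) set" +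
  assumes \<mu>: "\<mu> \<in> linear_maps R (tensor R A A) A"
    and \<Delta>: "\<Delta> \<in> linear_maps R C (tensor R C C)"
begin

abbreviation "H \<equiv> Hom_module R C A"
abbreviation "conv \<equiv> convolution R C A \<mu> \<Delta>"

lemma C_module: "module R C" and A_module: "module R A"
  by (rule C.module_axioms, rule A.module_axioms)

lemma H_module: "module R H"
  using C_module A_module by (rule Hom_module_module)

text \<open>For fixed \<open>t\<close> the composite is linear on \<open>C\<close>, so the value
  lies in \<open>H\<close>. For fixed \<open>x\<close> it is \<open>lambda2\<close>, then evaluation
  at \<open>\<Delta> x\<close>, then \<open>\<mu>\<close>, hence linear in \<open>t\<close>.\<close>

lemma conv_linear: "conv \<in> linear_maps R (tensor R H H) H"
proof -
  note HH = tensor_module[OF H_module H_module]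
    and CC = tensor_module[OF C_module C_module]
    and lam = lambda2_linear(1)[OF C_module A_module]
  show ?thesis
    unfolding convolution_def[abs_def]
  proof (intro linear_maps_into_Hom_moduleI Hom_module_carrierI HH C_module)
    fix t assume "t \<in> carrier (tensor R H H)"
    then have "lambda2 R C A t \<in> linear_maps R (tensor R C C) (tensor R A A)"
      by (intro Hom_module_linear linear_maps_closed[OF lam])
    from linear_maps_comp[OF linear_maps_comp[OF \<Delta> this] \<mu>]
    show "\<mu> \<circ> lambda2 R C A t \<circ> \<Delta> \<in> linear_maps R C A"
      by (simp add: comp_def)
  next
    fix x assume "x \<in> carrier C"
    then have "\<Delta> x \<in> carrier (tensor R C C)"
      by (rule linear_maps_closed[OF \<Delta>])
    from linear_maps_comp[OF linear_maps_comp[OF lam Hom_module_eval[OF this]] \<mu>]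
    show "(\<lambda>t. (\<mu> \<circ> lambda2 R C A t \<circ> \<Delta>) x) \<in> linear_maps R (tensor R H H) A"
      by (simp add: comp_def)
  qed
qed

lemma conv_tens:
  assumes "f \<in> carrier H" and "g \<in> carrier H" and "x \<in> carrier C"
  shows "conv (tens R H H f g) x = \<mu> (tensor_map R A A f g (\<Delta> x))"
  using assms linear_maps_closed[OF \<Delta>]
  by (simp add: convolution_def lambda2_tens[OF C_module A_module])

lemma conv_closed:
  assumes "f \<in> carrier H" and "g \<in> carrier H"
  shows "conv (tens R H H f g) \<in> carrier H"
  using conv_linear tens_closed[OF H_module H_module assms] by (rule linear_maps_closed)

text \<open>The map \<open>T\<close> of the overview.\<close>

definition "comult3 x = tensor_map R C (tensor R C C) id \<Delta> (\<Delta> x)"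

lemma comult3_closed:
  assumes "x \<in> carrier C"
  shows "comult3 x \<in> carrier (tensor_cube R C)"
  unfolding comult3_def tensor_cube_def
  using tensor_map_linear(1)[OF C_module C_module C_module tensor_module[OF C_module C_module]
      linear_maps_id \<Delta>] linear_maps_closed[OF \<Delta> assms]
  by (rule linear_maps_closed)

text \<open>The left bracketing produces \<open>\<Delta>\<close> applied to the first factor of
  \<open>\<Delta> x\<close>. Coassociativity rewrites that as \<open>tensor_assoc\<close> of
  \<open>comult3 x\<close>, and naturality of \<open>tensor_assoc\<close> moves the reassociation
  past the three maps.\<close>

lemma conv_conv_left:
  assumes f: "f \<in> carrier H" and g: "g \<in> carrier H" and h: "h \<in> carrier H"
    and coassoc: "tensor_map R (tensor R C C) C \<Delta> id (\<Delta> x) = tensor_assoc R C (comult3 x)"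
    and x: "x \<in> carrier C"
  shows "conv (tens R H H (conv (tens R H H f g)) h) x
    = \<mu> (tensor_map R A A \<mu> id (tensor_assoc R A (tensor_cube_map R A f g h (comult3 x))))"
proof -
  note C = C_module and A = A_module
  note CC = tensor_module[OF C C] and AA = tensor_module[OF A A]
  note lin = Hom_module_linear[OF f] Hom_module_linear[OF g] Hom_module_linear[OF h]
  note fg = conv_closed[OF f g]
  note fg_h = tensor_map_linear[OF C C A A Hom_module_linear[OF fg] lin(3)]
    and f_g = tensor_map_linear[OF C C A A lin(1,2)]
    and \<Delta>_id = tensor_map_linear[OF C C CC C \<Delta> linear_maps_id]
    and \<mu>_id = tensor_map_linear[OF AA A A A \<mu> linear_maps_id]
  note f_g_h = tensor_map_linear[OF CC C AA A f_g(1) lin(3)]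
    and cube = tensor_cube_map_linear[OF C A lin]
    and assocC = tensor_assoc_linear[OF C] and assocA = tensor_assoc_linear[OF A]
  have \<Delta>x: "\<Delta> x \<in> carrier (tensor R C C)"
    using \<Delta> x by (rule linear_maps_closed)
  \<comment> \<open>The definition of the convolution \<open>f \<star> g\<close>, read as a
    factorisation: comultiply the first factor, apply the three maps, multiply the first two
    results.\<close>
  have "tensor_map R A A (conv (tens R H H f g)) h (\<Delta> x)
    = tensor_map R A A \<mu> id (tensor_map R (tensor R A A) A (tensor_map R A A f g) h
        (tensor_map R (tensor R C C) C \<Delta> id (\<Delta> x)))"
    using C C fg_h(1) linear_maps_comp[OF linear_maps_comp[OF \<Delta>_id(1) f_g_h(1)] \<mu>_id(1)]
  proof (rule tensor_linear_eq)
    fix y z assume "y \<in> carrier C" "z \<in> carrier C"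
    then show "tensor_map R A A (conv (tens R H H f g)) h (tens R C C y z)
      = tensor_map R A A \<mu> id (tensor_map R (tensor R A A) A (tensor_map R A A f g) h
          (tensor_map R (tensor R C C) C \<Delta> id (tens R C C y z)))"
      by (simp add: fg_h(2) \<Delta>_id(2) f_g_h(2) \<mu>_id(2) conv_tens f g
          linear_maps_closed[OF \<Delta>] linear_maps_closed[OF f_g(1)] linear_maps_closed[OF lin(3)])
  qed (rule \<Delta>x)
  \<comment> \<open>Naturality of reassociation with respect to \<open>f\<close>, \<open>g\<close>,
    \<open>h\<close>.\<close>
  moreover have "tensor_map R (tensor R A A) A (tensor_map R A A f g) h (tensor_assoc R C u)
    = tensor_assoc R A (tensor_cube_map R A f g h u)" if "u \<in> carrier (tensor_cube R C)" for u
    using C linear_maps_comp[OF assocC(1) f_g_h(1)] linear_maps_comp[OF cube(1) assocA(1)]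
  proof (rule tensor_cube_linear_eq)
    fix p q r assume "p \<in> carrier C" "q \<in> carrier C" "r \<in> carrier C"
    then show "tensor_map R (tensor R A A) A (tensor_map R A A f g) h (tensor_assoc R C (tens3 R C p q r))
      = tensor_assoc R A (tensor_cube_map R A f g h (tens3 R C p q r))"
      by (simp add: assocC(2) f_g_h(2) f_g(2) cube(2) assocA(2) tens_closed[OF C C]
          linear_maps_closed[OF lin(1)] linear_maps_closed[OF lin(2)] linear_maps_closed[OF lin(3)])
  qed (rule that)
  ultimately show ?thesis
    by (simp add: conv_tens fg h x coassoc comult3_closed)
qed

text \<open>Here the factorisation splits the second factor of \<open>\<Delta> x\<close>, which is
  already the bracketing of \<open>comult3\<close>.\<close>

lemma conv_conv_right:
  assumes f: "f \<in> carrier H" and g: "g \<in> carrier H" and h: "h \<in> carrier H"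
    and x: "x \<in> carrier C"
  shows "conv (tens R H H f (conv (tens R H H g h))) x
    = \<mu> (tensor_map R A A id \<mu> (tensor_cube_map R A f g h (comult3 x)))"
proof -
  note C = C_module and A = A_module
  note CC = tensor_module[OF C C] and AA = tensor_module[OF A A]
  note lin = Hom_module_linear[OF f] Hom_module_linear[OF g] Hom_module_linear[OF h]
  note gh = conv_closed[OF g h]
  note f_gh = tensor_map_linear[OF C C A A lin(1) Hom_module_linear[OF gh]]
    and g_h = tensor_map_linear[OF C C A A lin(2,3)]
    and id_\<Delta> = tensor_map_linear[OF C C C CC linear_maps_id \<Delta>]
    and id_\<mu> = tensor_map_linear[OF A AA A A linear_maps_id \<mu>]
  note f_g_h = tensor_map_linear[OF C CC A AA lin(1) g_h(1)]
  have \<Delta>x: "\<Delta> x \<in> carrier (tensor R C C)"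
    using \<Delta> x by (rule linear_maps_closed)
  have "tensor_map R A A f (conv (tens R H H g h)) (\<Delta> x)
    = tensor_map R A A id \<mu> (tensor_map R A (tensor R A A) f (tensor_map R A A g h)
        (tensor_map R C (tensor R C C) id \<Delta> (\<Delta> x)))"
    using C C f_gh(1) linear_maps_comp[OF linear_maps_comp[OF id_\<Delta>(1) f_g_h(1)] id_\<mu>(1)]
  proof (rule tensor_linear_eq)
    fix y z assume "y \<in> carrier C" "z \<in> carrier C"
    then show "tensor_map R A A f (conv (tens R H H g h)) (tens R C C y z)
      = tensor_map R A A id \<mu> (tensor_map R A (tensor R A A) f (tensor_map R A A g h)
          (tensor_map R C (tensor R C C) id \<Delta> (tens R C C y z)))"
      by (simp add: f_gh(2) id_\<Delta>(2) f_g_h(2) id_\<mu>(2) conv_tens g h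
          linear_maps_closed[OF \<Delta>] linear_maps_closed[OF g_h(1)] linear_maps_closed[OF lin(1)])
  qed (rule \<Delta>x)
  then show ?thesis
    by (simp add: conv_tens f gh x comult3_def tensor_cube_map_def)
qed

lemma associator_conv:
  assumes f: "f \<in> carrier H" and g: "g \<in> carrier H" and h: "h \<in> carrier H"
    and coassoc: "tensor_map R (tensor R C C) C \<Delta> id (\<Delta> x) = tensor_assoc R C (comult3 x)"
    and x: "x \<in> carrier C"
  shows "associator R H conv (tens3 R H f g h) x
    = associator R A \<mu> (tensor_cube_map R A f g h (comult3 x))"
proof -
  have "associator R H conv (tens3 R H f g h) x
    = (conv (tens R H H (conv (tens R H H f g)) h) \<ominus>\<^bsub>H\<^esub> conv (tens R H H f (conv (tens R H H g h)))) x"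
    by (simp only: associator_tens3[OF H_module conv_linear f g h])
  \<comment> \<open>The difference is formed in \<open>H\<close>; linearity of evaluation at
    \<open>x\<close> turns it into a difference in \<open>A\<close>.\<close>
  also have "\<dots> = conv (tens R H H (conv (tens R H H f g)) h) x
      \<ominus>\<^bsub>A\<^esub> conv (tens R H H f (conv (tens R H H g h))) x"
    using Hom_module_eval[OF x] H_module A_module
    by (rule linear_maps_minus) (intro conv_closed f g h)+
  also have "\<dots> = associator R A \<mu> (tensor_cube_map R A f g h (comult3 x))"
    by (simp only: conv_conv_left[OF assms] conv_conv_right[OF f g h x] associator_def)
  finally show ?thesis .
qed

end

theorem proposition8:
  fixes R :: "('r, 'p) ring_scheme"
    and A :: "('r, 'a, 'q) module_scheme"
    and C :: "('r, 'c, 's) module_scheme"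
    and \<mu> :: "('a \<times> 'a \<Rightarrow> 'r) set \<Rightarrow> 'a"
    and \<Delta> :: "'c \<Rightarrow> ('c \<times> 'c \<Rightarrow> 'r) set"
    and i :: nat
  assumes "cring R"
    and "i \<in> {1..6}"
    and "G_associative_algebra (Sigma3_subgroup i) R A \<mu>"
    and "G_dual_coalgebra (Sigma3_subgroup i) R C \<Delta>"
  shows "G_associative_algebra (Sigma3_subgroup i) R (Hom_module R C A) (convolution R C A \<mu> \<Delta>)"
proof -
  let ?G = "Sigma3_subgroup i"
  interpret alg: G_associative_algebra ?G R A \<mu>
    by fact
  interpret coalg: G_dual_coalgebra ?G R C \<Delta>
    by fact
  interpret convolution_data R C A \<mu> \<Delta>
    by unfold_locales (rule alg.mult_linear, rule coalg.comult_linear)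
  note G = finite_Sigma3_subgroup[of i] Sigma3_subgroup_permutes[of _ i]
  have altH: "alternating_sum R H ?G \<in> linear_maps R (tensor_cube R H) (tensor_cube R H)"
    using H_module G by (rule alternating_sum_linear)
  note assocH = associator_linear[OF H_module conv_linear] and assocA = associator_linear[OF A_module \<mu>]
  have zero: "associator R H conv (alternating_sum R H ?G (tens3 R H f1 f2 f3)) x = \<zero>\<^bsub>A\<^esub>"
    if f123: "f1 \<in> carrier H" "f2 \<in> carrier H" "f3 \<in> carrier H" and x: "x \<in> carrier C"
    for f1 f2 f3 x
  proof -
    \<comment> \<open>Indexing the maps by numbers lets the permuted triple be written with the
      inverse of \<open>\<sigma>\<close>; the last branch keeps \<open>f k\<close> in
      \<open>H\<close> for all \<open>k\<close>.\<close>
    define f where "f = (\<lambda>k::nat. if k = 1 then f1 else if k = 2 then f2 else f3)"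
    have f: "f k \<in> carrier H" for k
      using f123 by (simp add: f_def)
    note f_lin = Hom_module_linear[OF f]
    let ?t = "tens3 R H (f 1) (f 2) (f 3)"
    let ?u = "tensor_cube_map R A (f 1) (f 2) (f 3) (comult3 x)"
    have u: "?u \<in> carrier (tensor_cube R A)"
      using tensor_cube_map_linear(1)[OF C_module A_module f_lin f_lin f_lin] comult3_closed[OF x]
      by (rule linear_maps_closed)
    have coassoc: "tensor_map R (tensor R C C) C \<Delta> id (\<Delta> x) = tensor_assoc R C (comult3 x)"
      using coalg.coassociative x by (simp add: comult3_def)
    have perm: "associator R H conv (perm_map R H \<sigma> ?t) x = associator R A \<mu> (perm_map R A \<sigma> ?u)"
      if \<sigma>: "\<sigma> \<in> ?G" for \<sigma>
    proof -
      have inv: "perm_map R C \<sigma> (comult3 x) = comult3 x"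
        using coalg.G_invariant \<sigma> x by (simp add: comult3_def)
      have "perm_map R H \<sigma> ?t
        = tens3 R H (f (inv_into UNIV \<sigma> 1)) (f (inv_into UNIV \<sigma> 2)) (f (inv_into UNIV \<sigma> 3))"
        using H_module G(2)[OF \<sigma>] f by (rule perm_map_tens3)
      \<comment> \<open>Invariance is used to insert the permutation of \<open>comult3 x\<close>
        under the permuted maps, where naturality can carry it to the outside.\<close>
      then have "associator R H conv (perm_map R H \<sigma> ?t) x
        = associator R A \<mu> (tensor_cube_map R A (f (inv_into UNIV \<sigma> 1)) (f (inv_into UNIV \<sigma> 2))
            (f (inv_into UNIV \<sigma> 3)) (perm_map R C \<sigma> (comult3 x)))"
        by (simp add: associator_conv f coassoc x inv)
      also have "\<dots> = associator R A \<mu> (perm_map R A \<sigma> ?u)"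
        using perm_map_tensor_cube_map[of R C A \<sigma> f, OF C_module A_module G(2)[OF \<sigma>] f_lin comult3_closed[OF x]]
        by (rule arg_cong)
      finally show ?thesis .
    qed
    have assoc_x: "(\<lambda>t. associator R H conv t x) \<in> linear_maps R (tensor_cube R H) A"
      using assocH(1) Hom_module_eval[OF x] by (rule linear_maps_comp)
    have t: "?t \<in> carrier (tensor_cube R H)"
      by (intro tens3_closed H_module f)
    \<comment> \<open>With \<open>x\<close> fixed, the associator of the convolution is linear in
      its tensor, so the signed sum can be taken out, compared termwise, and put back inside the
      associator of \<open>\<mu>\<close> at \<open>?u\<close>.\<close>
    have "associator R H conv (alternating_sum R H ?G ?t) x
      = (\<Oplus>\<^bsub>A\<^esub>\<sigma>\<in>?G. [sign \<sigma>] \<cdot>\<^bsub>A\<^esub> associator R H conv (perm_map R H \<sigma> ?t) x)"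
      using H_module G A_module assoc_x t by (rule linear_maps_alternating_sum)
    also have "\<dots> = (\<Oplus>\<^bsub>A\<^esub>\<sigma>\<in>?G. [sign \<sigma>] \<cdot>\<^bsub>A\<^esub> associator R A \<mu> (perm_map R A \<sigma> ?u))"
    proof (rule alg.M.finsum_cong'[OF refl])
      show "(\<lambda>\<sigma>. [sign \<sigma>] \<cdot>\<^bsub>A\<^esub> associator R A \<mu> (perm_map R A \<sigma> ?u)) \<in> ?G \<rightarrow> carrier A"
        by (intro Pi_I alg.M.add.int_pow_closed linear_maps_closed[OF assocA(1)]
            linear_maps_closed[OF perm_map_linear(1)[OF A_module]] G(2) u)
    qed (simp only: perm)
    also have "\<dots> = associator R A \<mu> (alternating_sum R A ?G ?u)"
      using A_module G A_module assocA(1) u by (rule linear_maps_alternating_sum[symmetric])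
    also have "\<dots> = \<zero>\<^bsub>A\<^esub>"
      using alg.G_associative u by blast
    finally show ?thesis
      by (simp add: f_def)
  qed
  \<comment> \<open>With \<open>x\<close> fixed this expression is linear in \<open>t\<close>, so it
    is compared with the zero map on pure tensors.\<close>
  have vanish: "associator R H conv (alternating_sum R H ?G t) x = \<zero>\<^bsub>A\<^esub>"
    if t: "t \<in> carrier (tensor_cube R H)" and x: "x \<in> carrier C" for t x
    using H_module linear_maps_comp[OF linear_maps_comp[OF altH assocH(1)] Hom_module_eval[OF x]] _ _ t
  proof (rule tensor_cube_linear_eq)
    show "(\<lambda>t. \<zero>\<^bsub>A\<^esub>) \<in> linear_maps R (tensor_cube R H) A"
      by (rule linear_mapsI) simp_all
  qed (rule zero[OF _ _ _ x])
  \<comment> \<open>Elements of \<open>H\<close> are extensional, so vanishing at every point of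
    \<open>C\<close> makes the element zero.\<close>
  have "associator R H conv (alternating_sum R H ?G t) = \<zero>\<^bsub>H\<^esub>"
    if t: "t \<in> carrier (tensor_cube R H)" for t
  proof (rule Hom_module_ext[rotated -1])
    show "associator R H conv (alternating_sum R H ?G t) \<in> carrier H"
      using assocH(1) linear_maps_closed[OF altH t] by (rule linear_maps_closed)
    show "\<zero>\<^bsub>H\<^esub> \<in> carrier H"
      using H_module by (simp add: module_def abelian_group_def abelian_monoid.zero_closed)
  qed (simp add: vanish[OF t], simp add: Hom_module_def)
  then show ?thesis
    using H_module conv_linear
    by (simp add: G_associative_algebra_def G_associative_algebra_axioms_def)
qed

end
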